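(* Let $g>0$ and $L>0$. Let $0<\tau<\sqrt{2L/g}$ and set $$\lambda_0 = \frac{-2+\sqrt{-\frac{g\tau^2}{L}+2}}{\tau}.$$ Assume that $\lambda_0\tau\geq -1$, and let $$k_d = \frac{2(\tau\lambda_0+1)\,\mathrm{e}^{\tau\lambda_0}}{\tau}, \qquad k_p = \frac{2\left(5L\tau\lambda_0 + g\tau^2 + 3L\right)\mathrm{e}^{\tau\lambda_0}}{\tau^2 L}.$$ Then the delayed PD controller $u(t) = -k_p\,\theta(t-\tau) - k_d\,\dot\theta(t-\tau)$ locally exponentially stabilizes the system $$\ddot\theta(t) + \frac{g}{L}\sin(\theta(t)) = u(t)$$ (at the equilibrium $\theta=0$). Furthermore, the intermediate MID property holds for the closed-loop system with exponential decay rate $\lambda_0$: $\lambda_0$ is a root of multiplicity $3$ of $$\Delta(\lambda) = \lambda^2 + \frac{g}{L} + (k_d\lambda + k_p)\,\mathrm{e}^{-\lambda\tau},$$ and every root $\lambda\in\mathbb{C}$ of $\Delta$ satisfies $\Re(\lambda)\leq\lambda_0$.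
   Context: Here $\theta$ is the angular displacement of a pendulum of length $L$ with respect to its stable equilibrium position, $g$ is the gravitational acceleration, and $u$ is the control input. $\Delta$ is the characteristic quasipolynomial of the linearization at $\theta=0$ of the closed-loop delay-differential equation. "Locally exponentially stabilizes" means that the trivial solution $\theta\equiv 0$ of the closed-loop delay-differential equation is locally exponentially stable. MID (multiplicity induced dominancy) property: a root $\lambda_0$ of $\Delta$ satisfies the MID property if its multiplicity is larger than one and it is dominant, i.e. all roots $\lambda$ of $\Delta$ satisfy $\Re(\lambda)\le\Re(\lambda_0)$; in that case $\Re(\lambda_0)$ is the spectral abscissa of $\Delta$ (this is the meaning of "exponential decay rate"). For a quasipolynomial $P_0(\lambda)+P_\tau(\lambda)\mathrm{e}^{-\lambda\tau}$ with $\deg P_0 = n$, $\deg P_\tau = m$, the MID property is called intermediate when the multiplicity $M(\lambda_0)$ satisfies $n+1\le M(\lambda_0)\le n+m$; here $n=2$, $m=1$, so the intermediate multiplicity is $3$. *)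

theory Defs
  imports "HOL-Complex_Analysis.Complex_Analysis"
    "HOL-Computational_Algebra.Polynomial"
begin

section \<open>Delay-differential equations with one discrete delay\<close>

text \<open>Solutions on \<open>[-\<tau>, \<infinity>)\<close> of \<open>x'(t) = F (x t) (x (t - \<tau>))\<close> for \<open>t \<ge> 0\<close>, with initial function
  \<open>\<phi>\<close> on \<open>[-\<tau>, 0]\<close>. At \<open>t = 0\<close> the derivative is the one from the right.\<close>

definition dde_solution ::
  "real \<Rightarrow> ('a \<Rightarrow> 'a \<Rightarrow> 'a) \<Rightarrow> (real \<Rightarrow> 'a) \<Rightarrow> (real \<Rightarrow> 'a::real_normed_vector) \<Rightarrow> bool" where
  "dde_solution \<tau> F \<phi> x \<longleftrightarrow>
     continuous_on {-\<tau>..} x \<and>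
     (\<forall>t\<in>{-\<tau>..0}. x t = \<phi> t) \<and>
     (\<forall>t\<ge>0. (x has_vector_derivative F (x t) (x (t - \<tau>))) (at t within {0..}))"

text \<open>Local exponential stability of the trivial solution, in the phase space \<open>C([-\<tau>, 0])\<close>
  with the supremum norm. Global existence of solutions for small initial functions is part
  of the notion.\<close>

definition locally_exponentially_stable ::
  "real \<Rightarrow> ('a \<Rightarrow> 'a \<Rightarrow> 'a::real_normed_vector) \<Rightarrow> bool" where
  "locally_exponentially_stable \<tau> F \<longleftrightarrow>
     (\<exists>\<delta>>0. \<exists>K>0. \<exists>\<alpha>>0. \<forall>\<phi>.
        continuous_on {-\<tau>..0} \<phi> \<longrightarrow> (SUP s\<in>{-\<tau>..0}. norm (\<phi> s)) \<le> \<delta> \<longrightarrow>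
          (\<exists>x. dde_solution \<tau> F \<phi> x) \<and>
          (\<forall>x. dde_solution \<tau> F \<phi> x \<longrightarrow>
             (\<forall>t\<ge>0. norm (x t) \<le> K * exp (- \<alpha> * t) * (SUP s\<in>{-\<tau>..0}. norm (\<phi> s)))))"

section \<open>The pendulum under delayed PD control\<close>

text \<open>States are pairs \<open>(\<theta>, \<theta>')\<close>. In \<open>pd_control\<close> the argument is the delayed state.\<close>

definition pd_control :: "real \<Rightarrow> real \<Rightarrow> real \<times> real \<Rightarrow> real" where
  "pd_control kp kd y = - kp * fst y - kd * snd y"

definition pendulum_field :: "real \<Rightarrow> real \<Rightarrow> real \<Rightarrow> real \<times> real \<Rightarrow> real \<times> real" where
  "pendulum_field g L u x = (snd x, - (g / L) * sin (fst x) + u)"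

definition pendulum_closed_loop ::
  "real \<Rightarrow> real \<Rightarrow> real \<Rightarrow> real \<Rightarrow> real \<times> real \<Rightarrow> real \<times> real \<Rightarrow> real \<times> real" where
  "pendulum_closed_loop g L kp kd x y = pendulum_field g L (pd_control kp kd y) x"

section \<open>Quasipolynomials and multiplicity-induced dominancy\<close>

definition quasipolynomial ::
  "real \<Rightarrow> complex poly \<Rightarrow> complex poly \<Rightarrow> complex \<Rightarrow> complex" where
  "quasipolynomial \<tau> P0 P1 z = poly P0 z + poly P1 z * exp (- z * of_real \<tau>)"

text \<open>The multiplicity of a root \<open>z0\<close> of an entire function \<open>f\<close>, not identically zero, is \<open>zorder f z0\<close>.\<close>

definition dominant_root :: "(complex \<Rightarrow> complex) \<Rightarrow> complex \<Rightarrow> bool" where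
  "dominant_root f z0 \<longleftrightarrow> f z0 = 0 \<and> (\<forall>z. f z = 0 \<longrightarrow> Re z \<le> Re z0)"

definition MID_property :: "(complex \<Rightarrow> complex) \<Rightarrow> complex \<Rightarrow> bool" where
  "MID_property f z0 \<longleftrightarrow> dominant_root f z0 \<and> zorder f z0 > 1"

text \<open>The degree of the delayed part is only bounded by \<open>m\<close>: the leading coefficient of that part
  is a control gain, which may vanish for particular parameter values.\<close>

definition intermediate_MID_property ::
  "real \<Rightarrow> nat \<Rightarrow> nat \<Rightarrow> (complex \<Rightarrow> complex) \<Rightarrow> complex \<Rightarrow> bool" where
  "intermediate_MID_property \<tau> n m f z0 \<longleftrightarrow>
     (\<exists>P0 P1. degree P0 = n \<and> degree P1 \<le> m \<and> f = quasipolynomial \<tau> P0 P1) \<and>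
     MID_property f z0 \<and> int (n + 1) \<le> zorder f z0 \<and> zorder f z0 \<le> int (n + m)"

definition spectral_abscissa :: "(complex \<Rightarrow> complex) \<Rightarrow> real" where
  "spectral_abscissa f = (SUP z\<in>{z. f z = 0}. Re z)"

end

theory Submission
  imports Defs
begin

text \<open>
  Write \<open>l\<close> for \<open>lam0\<close>, and put \<open>\<alpha> = - 2 * l\<close> and \<open>\<beta> = g / L + l\<^sup>2\<close>. The gains are chosen so that
  the quasipolynomial factors as
  \<open>\<Delta> z = (z - l)\<^sup>2 * (1 - k (z - l))\<close>, where \<open>k w\<close> is the Laplace transform at \<open>w\<close> of the affine function
  \<open>r \<mapsto> \<alpha> - \<beta> * r\<close> on \<open>[0, \<tau>]\<close>. The choice of \<open>l\<close> gives this function total mass one, and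
  \<open>l * \<tau> \<ge> - 1\<close> says precisely that its value at \<open>r = \<tau>\<close> is nonnegative, so it is a probability
  density. Both halves of the theorem rest on this single fact.

  Dominancy: for \<open>Re w > 0\<close> the transform of a probability density has modulus less than one,
  so \<open>\<Delta>\<close> has no root to the right of \<open>l\<close>. At \<open>w = 0\<close> the second factor vanishes, which raises
  the multiplicity of \<open>l\<close> from two to three.

  Stability: the same factorization can be read in the time domain. With \<open>\<psi> t = exp (- l * t) * \<theta> t\<close>,
  the defect \<open>v t = \<psi> t - (\<integral>r\<in>[0,\<tau>]. (\<alpha> - \<beta> * r) * \<psi> (t - r))\<close> satisfies \<open>v'' t = exp (- l * t) * f t\<close>
  for \<open>t \<ge> \<tau>\<close>, where \<open>f t = g / L * (\<theta> t - sin (\<theta> t))\<close> is the deviation from the linearization. This is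
  \<open>defect_deriv_has_derivative\<close>, the counterpart of \<open>quasipolynomial_factorization\<close>. Hence, for every
  \<open>m > 0\<close> and while \<open>\<theta>\<close> is small, the supremum of \<open>exp (- m * t) * \<bar>v t\<bar>\<close> is bounded by a multiple of the
  initial data plus a small multiple of the supremum of \<open>exp (- m * t) * \<bar>\<psi> t\<bar>\<close>. Recovering \<open>\<psi>\<close> from \<open>v\<close>
  costs only a factor \<open>1 / (1 - k m)\<close> in this weighted supremum, because \<open>k m < 1\<close>. With \<open>0 < m < - l\<close>
  this is exponential decay of \<open>\<theta>\<close> (\<open>perturbed_feedback_decays\<close>), as long as \<open>\<theta>\<close> stays small enough for \<open>f\<close>
  to be dominated by a small multiple of \<open>\<theta>\<close>; a solution that starts small never leaves that regime.
  Neither Laplace inversion nor a spectral theory of delay semigroups enters.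

  Two general facts about delay equations complete the argument. A globally Lipschitz vector field
  has global solutions (\<open>lipschitz_dde_solution_exists\<close>), and the solution on \<open>[0, \<tau>]\<close> is bounded by
  the initial function (\<open>dde_solution_first_interval_bound\<close>). The latter is needed since the defect
  can be differentiated twice only after one full delay: an initial function need not satisfy
  \<open>\<theta>' = \<omega>\<close> on \<open>[- \<tau>, 0]\<close>.
\<close>

section \<open>Delay equations with Lipschitz right-hand sides\<close>

lemma integral_from_0_has_vector_derivative:
  fixes f :: "real \<Rightarrow> 'a::banach"
  assumes f: "continuous_on {0..} f" and t: "0 \<le> t"
  shows "((\<lambda>u. integral {0..u} f) has_vector_derivative f t) (at t within {0..})"
proof -
  have "at t within {0..} = at t within {0..t + 1}"
    by (rule at_within_nhd[of _ "{..<t + 1}"]) auto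
  moreover have "continuous_on {0..t + 1} f"
    using f by (rule continuous_on_subset) auto
  ultimately show ?thesis
    using integral_has_vector_derivative[of 0 "t + 1" f t] t by simp
qed

text \<open>
  All Gronwall-type steps below are instances of this bound: a derivative of size \<open>C * exp (m * t)\<close> with
  \<open>m > 0\<close> integrates to a function of the same exponential type, with the gain \<open>1 / m\<close>.
\<close>

lemma norm_increment_le_exp:
  fixes f :: "real \<Rightarrow> 'a::real_normed_vector"
  assumes ab: "a \<le> b" and m: "m > 0"
    and f: "\<And>t. t \<in> {a..b} \<Longrightarrow> (f has_vector_derivative f' t) (at t within {a..b})"
    and bound: "\<And>t. t \<in> {a..b} \<Longrightarrow> norm (f' t) \<le> C * exp (m * t)"
  shows "norm (f b - f a) \<le> C / m * (exp (m * b) - exp (m * a))"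
proof (cases "a = b")
  case True
  then show ?thesis by simp
next
  case False
  with ab have "a < b" by simp
  have "norm (f b - f a) \<le> (\<lambda>t. C / m * exp (m * t)) b - (\<lambda>t. C / m * exp (m * t)) a"
  proof (rule differentiable_bound_general[OF \<open>a < b\<close>, where f' = f'])
    show "continuous_on {a..b} f"
      using f by (rule continuous_on_vector_derivative)
    show "continuous_on {a..b} (\<lambda>t. C / m * exp (m * t))"
      by (intro continuous_intros)
    fix t assume t: "a < t" "t < b"
    then show "(f has_vector_derivative f' t) (at t)"
      using f[of t] by (simp add: at_within_Icc_at)
    show "((\<lambda>t. C / m * exp (m * t)) has_vector_derivative C * exp (m * t)) (at t)"
      unfolding has_real_derivative_iff_has_vector_derivative[symmetric]
      using m by (auto intro!: derivative_eq_intros)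
    show "norm (f' t) \<le> C * exp (m * t)"
      using t by (intro bound) auto
  qed
  then show ?thesis by (simp add: right_diff_distrib)
qed

lemma norm_le_exp:
  fixes f :: "real \<Rightarrow> 'a::real_normed_vector"
  assumes ab: "a \<le> b" and m: "m > 0" and C: "C \<ge> 0"
    and f: "\<And>t. t \<in> {a..b} \<Longrightarrow> (f has_vector_derivative f' t) (at t within {a..b})"
    and bound: "\<And>t. t \<in> {a..b} \<Longrightarrow> norm (f' t) \<le> C * exp (m * t)"
  shows "norm (f b) \<le> norm (f a) + C / m * exp (m * b)"
proof -
  have "norm (f b - f a) \<le> C / m * (exp (m * b) - exp (m * a))"
    using ab m f bound by (rule norm_increment_le_exp)
  also have "\<dots> \<le> C / m * exp (m * b)"
    using m C by (intro mult_left_mono) auto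
  finally show ?thesis
    using norm_triangle_sub[of "f b" "f a"] by linarith
qed

definition lipschitz_field :: "real \<Rightarrow> ('a \<Rightarrow> 'a \<Rightarrow> 'a::real_normed_vector) \<Rightarrow> bool" where
  "lipschitz_field K F \<longleftrightarrow> 0 < K \<and>
     (\<forall>x y x' y'. norm (F x y - F x' y') \<le> K * (norm (x - x') + norm (y - y')))"

lemma lipschitz_fieldD:
  "lipschitz_field K F \<Longrightarrow> norm (F x y - F x' y') \<le> K * (norm (x - x') + norm (y - y'))"
  by (simp add: lipschitz_field_def)

lemma continuous_on_lipschitz_field:
  fixes F :: "'a::real_normed_vector \<Rightarrow> 'a \<Rightarrow> 'a"
  assumes F: "lipschitz_field K F" and "continuous_on S a" "continuous_on S b"
  shows "continuous_on S (\<lambda>s. F (a s) (b s))"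
proof -
  have "(2 * K)-lipschitz_on UNIV (\<lambda>p. F (fst p) (snd p))"
  proof (rule lipschitz_onI)
    show "0 \<le> 2 * K" using F by (simp add: lipschitz_field_def)
    fix p q :: "'a \<times> 'a"
    have "dist (F (fst p) (snd p)) (F (fst q) (snd q))
        \<le> K * (dist (fst p) (fst q) + dist (snd p) (snd q))"
      using lipschitz_fieldD[OF F] by (simp add: dist_norm)
    also have "\<dots> \<le> K * (dist p q + dist p q)"
      using F by (intro mult_left_mono add_mono dist_fst_le dist_snd_le)
        (simp add: lipschitz_field_def)
    finally show "dist (F (fst p) (snd p)) (F (fst q) (snd q)) \<le> 2 * K * dist p q"
      by simp
  qed
  from lipschitz_on_continuous_on[OF this]
  have "continuous_on UNIV (\<lambda>p. F (fst p) (snd p))" .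
  from continuous_on_compose2[OF this, of S "\<lambda>s. (a s, b s)"] assms(2,3)
  show ?thesis by (simp add: continuous_on_Pair)
qed

text \<open>
  A solution on \<open>[0, \<infinity>)\<close> is the fixed point of the Picard operator. Measuring functions in the norm
  \<open>sup \<bar>exp (- m * t) * x t\<bar>\<close> with \<open>m\<close> large compared with the Lipschitz constant makes this
  operator a contraction on the whole half-line at once, which avoids both the method of steps and
  a continuation argument.
\<close>

lemma lipschitz_dde_solution_exists:
  fixes F :: "'a::banach \<Rightarrow> 'a \<Rightarrow> 'a"
  assumes tau: "0 < \<tau>" and F: "lipschitz_field K F" and phi: "continuous_on {-\<tau>..0} \<phi>"
  shows "\<exists>x. dde_solution \<tau> F \<phi> x"
proof -
  define m where "m = 4 * K"
  have K: "K > 0" using F by (simp add: lipschitz_field_def)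
  then have m: "m > 0" by (simp add: m_def)
  define \<phi>' where "\<phi>' s = \<phi> (max (-\<tau>) (min 0 s))" for s
  have phi'_cont: "continuous_on S \<phi>'" for S
    unfolding \<phi>'_def using tau
    by (intro continuous_on_compose2[OF phi] continuous_intros) auto
  have "bounded (\<phi> ` {-\<tau>..0})"
    by (intro compact_imp_bounded compact_continuous_image phi) simp
  then obtain P where "\<And>s. s \<in> {-\<tau>..0} \<Longrightarrow> norm (\<phi> s) \<le> P"
    unfolding bounded_iff by blast
  then have P: "norm (\<phi>' s) \<le> P" for s
    unfolding \<phi>'_def using tau by auto
  then have "P \<ge> 0" using norm_ge_zero order_trans by blast
  \<comment> \<open>The unknown \<open>y\<close> is the weighted increment \<open>exp (- m * t) * (x t - \<phi> 0)\<close>. Clamping the time arguments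
     turns it into a bounded continuous function on the whole line, so that the contraction
     principle applies in a complete space; a fixed point has \<open>y 0 = 0\<close> and therefore
     restricts to \<open>\<phi>\<close> on \<open>[- \<tau>, 0]\<close>.\<close>
  define X where "X y s = \<phi>' s + exp (m * max 0 s) *\<^sub>R apply_bcontfun y (max 0 s)"
    for y :: "real \<Rightarrow>\<^sub>C 'a" and s
  define G where "G y s = F (X y s) (X y (s - \<tau>))" for y s
  have X_cont: "continuous_on S (X y)" for S y
    unfolding X_def
    by (intro continuous_intros phi'_cont continuous_on_compose2[OF continuous_on_apply_bcontfun]) auto
  have G_cont: "continuous_on S (G y)" for S y
    unfolding G_def
    by (intro continuous_on_lipschitz_field[OF F] X_cont
        continuous_on_compose2[OF X_cont[of UNIV]] continuous_intros) auto
  have exp_le: "exp (m * max 0 (s - \<tau>)) \<le> exp (m * s)" if "s \<ge> 0" for s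
    using that m tau by simp
  have X_norm: "norm (X y s') \<le> (P + norm y) * exp (m * s)" if "s' = s \<or> s' = s - \<tau>" "s \<ge> 0" for y s s'
  proof -
    have e: "exp (m * max 0 s') \<le> exp (m * s)" using exp_le that by auto
    have "norm (X y s') \<le> P + exp (m * max 0 s') * norm y"
      unfolding X_def
      by (intro order_trans[OF norm_triangle_ineq] add_mono P) (simp add: norm_bounded)
    also have "\<dots> \<le> P * exp (m * s) + exp (m * s) * norm y"
      using m \<open>P \<ge> 0\<close> \<open>s \<ge> 0\<close> e by (intro add_mono mult_right_mono) (auto simp: mult_le_cancel_left1)
    finally show ?thesis by (simp add: algebra_simps)
  qed
  define I where "I y t = integral {0..t} (G y)" for y t
  have I_deriv: "(I y has_vector_derivative G y t) (at t within {0..})" if "t \<ge> 0" for y t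
    unfolding I_def by (intro integral_from_0_has_vector_derivative G_cont that)
  have I_0: "I y 0 = 0" for y by (simp add: I_def)
  define T where "T y t = exp (- m * max 0 t) *\<^sub>R I y (max 0 t)" for y t
  have T_cont: "continuous_on UNIV (T y)" for y
  proof -
    have I_cont: "continuous_on {0..} (I y)"
      by (rule continuous_on_vector_derivative) (auto intro: I_deriv)
    show ?thesis
      unfolding T_def
      by (intro continuous_on_scaleR continuous_on_compose2[OF I_cont] continuous_intros) auto
  qed
  have scaled: "norm (exp (- m * t) *\<^sub>R z) \<le> c" if "norm z \<le> c * exp (m * t)" for t z c
    using that by (simp add: exp_minus field_simps)
  have "norm (T y t) \<le> (norm (F 0 0) + 2 * K * (P + norm y)) / m" for y t
    unfolding T_def
  proof (rule scaled)
    define C where "C = norm (F 0 0) + 2 * K * (P + norm y)"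
    have G_norm: "norm (G y s) \<le> C * exp (m * s)" if "s \<ge> 0" for s
    proof -
      have "norm (G y s) \<le> norm (F 0 0) + K * (norm (X y s) + norm (X y (s - \<tau>)))"
        using lipschitz_fieldD[OF F, of "X y s" "X y (s - \<tau>)" 0 0]
          norm_triangle_sub[of "G y s" "F 0 0"] by (simp add: G_def)
      also have "\<dots> \<le> norm (F 0 0) * exp (m * s)
          + K * ((P + norm y) * exp (m * s) + (P + norm y) * exp (m * s))"
        using K m that X_norm[of s s y] X_norm[of "s - \<tau>" s y]
        by (intro add_mono mult_left_mono) (auto simp: mult_le_cancel_left1)
      finally show ?thesis by (simp add: C_def algebra_simps)
    qed
    have "norm (I y (max 0 t)) \<le> norm (I y 0) + C / m * exp (m * max 0 t)"
    proof (rule norm_le_exp[where f' = "G y"])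
      show "C \<ge> 0" using K \<open>P \<ge> 0\<close> by (simp add: C_def)
      show "(I y has_vector_derivative G y s) (at s within {0..max 0 t})" if "s \<in> {0..max 0 t}" for s
        using that by (intro has_vector_derivative_within_subset[OF I_deriv]) auto
    qed (use m G_norm in auto)
    then show "norm (I y (max 0 t)) \<le> C / m * exp (m * max 0 t)"
      by (simp add: I_0)
  qed
  then have T_bcontfun: "T y \<in> bcontfun" for y
    using T_cont bcontfun_normI by blast
  define B where "B y = Bcontfun (T y)" for y
  have B: "apply_bcontfun (B y) = T y" for y
    using T_bcontfun by (simp add: B_def Bcontfun_inverse)
  have contract: "dist (B y) (B y') \<le> 1 / 2 * dist y y'" for y y'
  proof (rule dist_bound)
    fix t
    have X_diff: "norm (X y s' - X y' s') \<le> dist y y' * exp (m * s)"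
      if "s' = s \<or> s' = s - \<tau>" "s \<ge> 0" for s s'
    proof -
      have "norm (X y s' - X y' s')
          = exp (m * max 0 s') * dist (apply_bcontfun y (max 0 s')) (apply_bcontfun y' (max 0 s'))"
        by (simp add: X_def dist_norm flip: scaleR_diff_right)
      also have "\<dots> \<le> exp (m * s) * dist y y'"
        using exp_le that by (intro mult_mono dist_bounded) auto
      finally show ?thesis by (simp add: mult.commute)
    qed
    have G_diff: "norm (G y s - G y' s) \<le> 2 * K * dist y y' * exp (m * s)" if "s \<ge> 0" for s
    proof -
      have "norm (G y s - G y' s)
          \<le> K * (norm (X y s - X y' s) + norm (X y (s - \<tau>) - X y' (s - \<tau>)))"
        unfolding G_def by (rule lipschitz_fieldD[OF F])
      also have "\<dots> \<le> K * (dist y y' * exp (m * s) + dist y y' * exp (m * s))"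
        using K X_diff that by (intro mult_left_mono add_mono) auto
      finally show ?thesis by (simp add: algebra_simps)
    qed
    have "norm (I y (max 0 t) - I y' (max 0 t))
        \<le> norm (I y 0 - I y' 0) + 2 * K * dist y y' / m * exp (m * max 0 t)"
    proof (rule norm_le_exp[where f' = "\<lambda>s. G y s - G y' s"])
      show "((\<lambda>t. I y t - I y' t) has_vector_derivative G y s - G y' s) (at s within {0..max 0 t})"
        if "s \<in> {0..max 0 t}" for s
        using that
        by (intro has_vector_derivative_within_subset[OF has_vector_derivative_diff[OF I_deriv I_deriv]])
          auto
    qed (use m K G_diff in auto)
    then have "norm (I y (max 0 t) - I y' (max 0 t)) \<le> 1 / 2 * dist y y' * exp (m * max 0 t)"
      using K by (simp add: I_0 m_def)
    from scaled[OF this] show "dist (apply_bcontfun (B y) t) (apply_bcontfun (B y') t) \<le> 1 / 2 * dist y y'"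
      by (simp add: B T_def dist_norm flip: scaleR_diff_right)
  qed
  have "\<exists>!y. B y = y"
    by (rule banach_fix_type[of "1 / 2"]) (use contract in auto)
  then obtain y where y: "B y = y" by blast
  have X_eq: "X y t = \<phi>' t + I y (max 0 t)" for t
  proof -
    have "apply_bcontfun y (max 0 t) = T y (max 0 t)" using B[of y] y by simp
    then show ?thesis by (simp add: X_def T_def exp_minus)
  qed
  have "dde_solution \<tau> F \<phi> (X y)"
    unfolding dde_solution_def
  proof (intro conjI ballI allI impI)
    show "X y t = \<phi> t" if "t \<in> {-\<tau>..0}" for t
      using that by (simp add: X_eq I_0 \<phi>'_def)
    fix t :: real assume t: "t \<ge> 0"
    have "((\<lambda>t. \<phi> 0 + I y t) has_vector_derivative G y t) (at t within {0..})"
      using has_vector_derivative_add[OF has_vector_derivative_const I_deriv[OF t]] by simp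
    then show "(X y has_vector_derivative F (X y t) (X y (t - \<tau>))) (at t within {0..})"
      unfolding G_def
      by (rule has_vector_derivative_transform[rotated 2]) (use t tau in \<open>auto simp: X_eq \<phi>'_def\<close>)
  qed (rule X_cont)
  then show ?thesis by (rule exI[of _ "X y"])
qed

text \<open>
  A Gronwall estimate: the maximum over \<open>[0, \<tau>]\<close> of \<open>exp (- m * s) * norm (x s)\<close> is attained, and with
  \<open>m = 4 * K\<close> the integrated equation at the maximizer bounds it by a quarter of itself plus a
  multiple of \<open>N\<close>.
\<close>

lemma dde_solution_first_interval_bound:
  assumes sol: "dde_solution \<tau> F \<phi> x" and tau: "0 < \<tau>"
    and F: "lipschitz_field K F" "F 0 0 = 0"
    and phi: "\<And>s. s \<in> {-\<tau>..0} \<Longrightarrow> norm (\<phi> s) \<le> N" and t: "t \<in> {0..\<tau>}"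
  shows "norm (x t) \<le> 4 * exp (4 * K * \<tau>) * N"
proof -
  have K: "K > 0" using F by (simp add: lipschitz_field_def)
  define m where "m = 4 * K"
  have m: "m > 0" using K by (simp add: m_def)
  have x_phi: "x s = \<phi> s" if "s \<in> {-\<tau>..0}" for s
    using sol that by (simp add: dde_solution_def)
  have x_deriv: "(x has_vector_derivative F (x s) (x (s - \<tau>))) (at s within {0..})" if "s \<ge> 0" for s
    using sol that by (simp add: dde_solution_def)
  have "continuous_on {0..\<tau>} x"
    using sol tau by (auto simp: dde_solution_def elim: continuous_on_subset)
  then have "continuous_on {0..\<tau>} (\<lambda>s. exp (- m * s) * norm (x s))"
    by (intro continuous_intros)
  then obtain c where c: "c \<in> {0..\<tau>}"
    and c_max: "\<And>s. s \<in> {0..\<tau>} \<Longrightarrow> exp (- m * s) * norm (x s) \<le> exp (- m * c) * norm (x c)"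
    using continuous_attains_sup[of "{0..\<tau>}" "\<lambda>s. exp (- m * s) * norm (x s)"] tau by auto
  define M where "M = exp (- m * c) * norm (x c)"
  have "M \<ge> 0" by (simp add: M_def)
  have x_le: "norm (x s) \<le> M * exp (m * s)" if "s \<in> {0..\<tau>}" for s
    using c_max[OF that] by (simp add: M_def exp_minus field_simps)
  have "norm (\<phi> 0) \<le> N" using phi tau by auto
  then have N: "N \<ge> 0" using norm_ge_zero order_trans by blast
  have "norm (x c) \<le> norm (x 0) + K * (M + N) / m * exp (m * c)"
  proof (rule norm_le_exp[where f' = "\<lambda>s. F (x s) (x (s - \<tau>))"])
    fix s assume s: "s \<in> {0..c}"
    then show "(x has_vector_derivative F (x s) (x (s - \<tau>))) (at s within {0..c})"
      by (intro has_vector_derivative_within_subset[OF x_deriv]) auto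
    have "norm (F (x s) (x (s - \<tau>))) \<le> K * (norm (x s) + norm (x (s - \<tau>)))"
      using lipschitz_fieldD[OF F(1), of "x s" "x (s - \<tau>)" 0 0] F(2) by simp
    also have "\<dots> \<le> K * (M * exp (m * s) + N * exp (m * s))"
    proof (intro mult_left_mono add_mono)
      have "norm (x (s - \<tau>)) \<le> N" using s c phi x_phi by auto
      also have "\<dots> \<le> N * exp (m * s)" using s m N by (simp add: mult_le_cancel_left1)
      finally show "norm (x (s - \<tau>)) \<le> N * exp (m * s)" .
    qed (use s c x_le K in auto)
    finally show "norm (F (x s) (x (s - \<tau>))) \<le> K * (M + N) * exp (m * s)"
      by (simp add: algebra_simps)
  qed (use c m K \<open>M \<ge> 0\<close> N in auto)
  also have "norm (x 0) \<le> N * exp (m * c)"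
  proof -
    have "norm (x 0) \<le> N" using x_phi phi tau by auto
    also have "\<dots> \<le> N * exp (m * c)" using c m N by (simp add: mult_le_cancel_left1)
    finally show ?thesis .
  qed
  also have "N * exp (m * c) + K * (M + N) / m * exp (m * c) = (N + (M + N) / 4) * exp (m * c)"
    using K by (simp add: m_def distrib_right)
  finally have "M \<le> N + (M + N) / 4"
    by (simp add: M_def exp_minus field_simps)
  then have "M \<le> 4 * N" using N by (simp add: field_simps)
  have "norm (x t) \<le> M * exp (m * t)" by (rule x_le[OF t])
  also have "\<dots> \<le> 4 * N * exp (m * \<tau>)"
    using t m N \<open>M \<le> 4 * N\<close> by (intro mult_mono) auto
  finally show ?thesis by (simp add: m_def mult_ac)
qed

section \<open>Laplace transforms of affine probability densities\<close>

text \<open>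
  The Laplace transform \<open>\<integral>r\<in>[0,\<tau>]. (\<alpha> - \<beta> * r) * exp (- \<zeta> * r)\<close>, written with \<open>s = - r\<close>, which is the form in
  which it appears in a sliding time window. The scalar type is left open because the complex
  transform governs the roots and the real one the decay of solutions.
\<close>

definition kernel_transform :: "real \<Rightarrow> real \<Rightarrow> real \<Rightarrow> 'a::{real_normed_field,banach} \<Rightarrow> 'a" where
  "kernel_transform \<alpha> \<beta> \<tau> \<zeta> =
     integral {-\<tau>..0} (\<lambda>s. of_real (\<alpha> + \<beta> * s) * exp (\<zeta> * of_real s))"

text \<open>
  The integrand has an elementary primitive. Evaluating it over an arbitrary window, and not only over
  \<open>[- \<tau>, 0]\<close>, gives at the same time the closed form of the transform and the identity that convolution with the kernel
  multiplies \<open>exp (\<zeta> * t)\<close> by the transform at \<open>\<zeta>\<close>.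
\<close>

lemma kernel_window_has_integral:
  fixes \<zeta> :: "'a::{real_normed_field,banach}"
  assumes "\<zeta> \<noteq> 0" "0 \<le> \<tau>"
  shows "((\<lambda>s. of_real (\<alpha> - \<beta> * (t - s)) * exp (\<zeta> * of_real s)) has_integral
      exp (\<zeta> * of_real t) * (of_real \<alpha> / \<zeta> - of_real \<beta> / \<zeta>\<^sup>2
        - (of_real (\<alpha> - \<beta> * \<tau>) / \<zeta> - of_real \<beta> / \<zeta>\<^sup>2) * exp (- \<zeta> * of_real \<tau>)))
    {t - \<tau>..t}"
proof -
  let ?G = "\<lambda>z::'a. (of_real \<alpha> / \<zeta> - of_real \<beta> * (of_real t - z) / \<zeta> - of_real \<beta> / \<zeta>\<^sup>2) * exp (\<zeta> * z)"
  have "(?G has_field_derivative (of_real \<alpha> - of_real \<beta> * (of_real t - z)) * exp (\<zeta> * z)) (at z)"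
    for z
  proof -
    have "(?G has_field_derivative of_real \<beta> / \<zeta> * exp (\<zeta> * z)
        + (of_real \<alpha> / \<zeta> - of_real \<beta> * (of_real t - z) / \<zeta> - of_real \<beta> / \<zeta>\<^sup>2) * \<zeta> * exp (\<zeta> * z)) (at z)"
      using assms(1) by (auto intro!: derivative_eq_intros simp del: times_divide_eq_left)
    also have "(of_real \<alpha> / \<zeta> - of_real \<beta> * (of_real t - z) / \<zeta> - of_real \<beta> / \<zeta>\<^sup>2) * \<zeta>
        = of_real \<alpha> - of_real \<beta> * (of_real t - z) - of_real \<beta> / \<zeta>"
      using assms(1) by (simp add: left_diff_distrib power2_eq_square)
    also have "of_real \<beta> / \<zeta> * exp (\<zeta> * z)
        + (of_real \<alpha> - of_real \<beta> * (of_real t - z) - of_real \<beta> / \<zeta>) * exp (\<zeta> * z)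
        = (of_real \<alpha> - of_real \<beta> * (of_real t - z)) * exp (\<zeta> * z)"
      by (simp add: left_diff_distrib)
    finally show ?thesis .
  qed
  then have deriv: "((\<lambda>s. ?G (of_real s)) has_vector_derivative
      (of_real \<alpha> - of_real \<beta> * (of_real t - of_real s)) * exp (\<zeta> * of_real s)) (at s within S)"
    for s and S :: "real set"
    by (rule has_vector_derivative_real_field)
  have "((\<lambda>s. (of_real \<alpha> - of_real \<beta> * (of_real t - of_real s)) * exp (\<zeta> * of_real s)) has_integral
      ?G (of_real t) - ?G (of_real (t - \<tau>))) {t - \<tau>..t}"
    by (intro fundamental_theorem_of_calculus deriv) (use assms in auto)
  also have "?G (of_real t) - ?G (of_real (t - \<tau>))
     = exp (\<zeta> * of_real t) * (of_real \<alpha> / \<zeta> - of_real \<beta> / \<zeta>\<^sup>2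
        - (of_real (\<alpha> - \<beta> * \<tau>) / \<zeta> - of_real \<beta> / \<zeta>\<^sup>2) * exp (- \<zeta> * of_real \<tau>))"
  proof -
    have "\<zeta> * of_real (t - \<tau>) = \<zeta> * of_real t + - \<zeta> * of_real \<tau>"
      by (simp add: right_diff_distrib)
    then have e: "exp (\<zeta> * of_real (t - \<tau>)) = exp (\<zeta> * of_real t) * exp (- \<zeta> * of_real \<tau>)"
      by (simp only: exp_add)
    have c: "of_real \<alpha> / \<zeta> - of_real \<beta> * (of_real t - of_real (t - \<tau>)) / \<zeta> = of_real (\<alpha> - \<beta> * \<tau>) / \<zeta>"
      by (simp add: diff_divide_distrib)
    have "a * x - b * (x * y) = x * (a - b * y)" for a b x y :: 'a
      by (simp only: right_diff_distrib mult.left_commute mult.commute)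
    then show ?thesis unfolding e c by simp
  qed
  finally show ?thesis by simp
qed

lemma kernel_transform_eq:
  fixes \<zeta> :: "'a::{real_normed_field,banach}"
  assumes "\<zeta> \<noteq> 0" "0 \<le> \<tau>"
  shows "kernel_transform \<alpha> \<beta> \<tau> \<zeta> = of_real \<alpha> / \<zeta> - of_real \<beta> / \<zeta>\<^sup>2
        - (of_real (\<alpha> - \<beta> * \<tau>) / \<zeta> - of_real \<beta> / \<zeta>\<^sup>2) * exp (- \<zeta> * of_real \<tau>)"
  using integral_unique[OF kernel_window_has_integral[OF assms, of \<alpha> \<beta> 0]]
  by (simp add: kernel_transform_def)

text \<open>
  An affine function on \<open>[0, \<tau>]\<close> that is nonnegative at both ends is nonnegative in between, so these
  conditions say that \<open>r \<mapsto> \<alpha> - \<beta> * r\<close> is a probability density on \<open>[0, \<tau>]\<close>.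
\<close>

locale probability_kernel =
  fixes \<alpha> \<beta> \<tau> :: real
  assumes delay_pos: "0 < \<tau>" and \<alpha>_pos: "0 < \<alpha>" and end_nonneg: "0 \<le> \<alpha> - \<beta> * \<tau>"
    and mass: "\<alpha> * \<tau> - \<beta> * \<tau>\<^sup>2 / 2 = 1"
begin

lemma kernel_convex_combination:
  "\<alpha> - \<beta> * r = (1 - r / \<tau>) * \<alpha> + r / \<tau> * (\<alpha> - \<beta> * \<tau>)"
  using delay_pos by (simp add: field_simps)

lemma kernel_nonneg: "0 \<le> r \<Longrightarrow> r \<le> \<tau> \<Longrightarrow> 0 \<le> \<alpha> - \<beta> * r"
  using delay_pos \<alpha>_pos end_nonneg
  by (subst kernel_convex_combination, intro add_nonneg_nonneg mult_nonneg_nonneg) auto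

lemma kernel_pos: "0 \<le> r \<Longrightarrow> r < \<tau> \<Longrightarrow> 0 < \<alpha> - \<beta> * r"
  using delay_pos \<alpha>_pos end_nonneg
  by (subst kernel_convex_combination, intro add_pos_nonneg mult_pos_pos mult_nonneg_nonneg) auto

lemma kernel_has_mass_one: "((\<lambda>s. \<alpha> + \<beta> * s) has_integral 1) {-\<tau>..0}"
proof -
  have "((\<lambda>s. \<alpha> + \<beta> * s) has_integral
      (\<alpha> * 0 + \<beta> * 0\<^sup>2 / 2) - (\<alpha> * (-\<tau>) + \<beta> * (-\<tau>)\<^sup>2 / 2)) {-\<tau>..0}"
    by (rule fundamental_theorem_of_calculus)
      (use delay_pos in \<open>auto intro!: derivative_eq_intros
        simp flip: has_real_derivative_iff_has_vector_derivative\<close>)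
  then show ?thesis using mass by simp
qed

lemma kernel_transform_less_one:
  fixes m :: real
  assumes m: "m > 0"
  shows "kernel_transform \<alpha> \<beta> \<tau> m < 1"
proof -
  have "integral {-\<tau>..0} (\<lambda>s. (\<alpha> + \<beta> * s) * exp (m * s)) < integral {-\<tau>..0} (\<lambda>s. \<alpha> + \<beta> * s)"
  proof (rule integral_less_real)
    fix s assume "s \<in> {-\<tau><..<0}"
    then show "(\<alpha> + \<beta> * s) * exp (m * s) < \<alpha> + \<beta> * s"
      using m kernel_pos[of "- s"] by (simp add: mult_less_cancel_left1 mult_pos_neg)
  qed (use delay_pos in \<open>auto intro!: continuous_intros\<close>)
  then show ?thesis
    using integral_unique[OF kernel_has_mass_one] by (simp add: kernel_transform_def)
qed

text \<open>The triangle inequality reduces the complex transform to the real one, as the density is nonnegative.\<close>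

lemma norm_kernel_transform_less_one:
  fixes \<zeta> :: complex
  assumes "Re \<zeta> > 0"
  shows "norm (kernel_transform \<alpha> \<beta> \<tau> \<zeta>) < 1"
proof -
  have "norm (kernel_transform \<alpha> \<beta> \<tau> \<zeta>) \<le> kernel_transform \<alpha> \<beta> \<tau> (Re \<zeta>)"
    unfolding kernel_transform_def of_real_eq_id id_apply
  proof (intro integral_norm_bound_integral integrable_continuous_real continuous_intros)
    show "norm (of_real (\<alpha> + \<beta> * s) * exp (\<zeta> * of_real s)) \<le> (\<alpha> + \<beta> * s) * exp (Re \<zeta> * s)"
      if "s \<in> {-\<tau>..0}" for s
      using that kernel_nonneg[of "- s"] by (simp add: norm_mult del: of_real_add of_real_mult)
  qed
  also have "\<dots> < 1" using assms by (rule kernel_transform_less_one)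
  finally show ?thesis .
qed

end

text \<open>
  The left-hand side exhibits what the right-hand side, a quasipolynomial in the variable \<open>w = z - l\<close>,
  conceals: its nonzero roots are the points at which the kernel transform takes the value one.
\<close>

lemma quasipolynomial_factorization:
  fixes w :: "'a::{real_normed_field,banach}"
  assumes "w \<noteq> 0" "\<tau> \<ge> 0"
  shows "w\<^sup>2 * (1 - kernel_transform \<alpha> \<beta> \<tau> w) = w\<^sup>2 - of_real \<alpha> * w + of_real \<beta>
    + (of_real (\<alpha> - \<beta> * \<tau>) * w - of_real \<beta>) * exp (- w * of_real \<tau>)"
proof -
  have cancel: "w\<^sup>2 * (x / w) = x * w" "w\<^sup>2 * (x / w\<^sup>2) = x" for x
    using \<open>w \<noteq> 0\<close> by (simp_all add: power2_eq_square)
  have "w\<^sup>2 * (1 - (a / w - b / w\<^sup>2 - (c / w - b / w\<^sup>2) * e)) = w\<^sup>2 - a * w + b + (c * w - b) * e"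
    for a b c e
  proof -
    have "w\<^sup>2 * (1 - (a / w - b / w\<^sup>2 - (c / w - b / w\<^sup>2) * e))
        = w\<^sup>2 - w\<^sup>2 * (a / w) + w\<^sup>2 * (b / w\<^sup>2) + (w\<^sup>2 * (c / w) - w\<^sup>2 * (b / w\<^sup>2)) * e"
      by (simp add: right_diff_distrib left_diff_distrib mult.assoc)
    then show ?thesis by (simp only: cancel)
  qed
  then show ?thesis unfolding kernel_transform_eq[OF assms] .
qed

section \<open>The feedback system in the time domain\<close>

lemma window_integral_has_vector_derivative:
  fixes f :: "real \<Rightarrow> 'a::banach"
  assumes f: "continuous_on {0..} f" and "0 \<le> \<tau>" "\<tau> \<le> t"
  shows "((\<lambda>u. integral {u - \<tau>..u} f) has_vector_derivative f t - f (t - \<tau>)) (at t within {\<tau>..})"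
proof -
  let ?I = "\<lambda>u. integral {0..u} f"
  have "(?I has_vector_derivative f t) (at t within {\<tau>..})"
    using assms
    by (intro has_vector_derivative_within_subset[OF integral_from_0_has_vector_derivative]) auto
  moreover have "((?I \<circ> (\<lambda>u. u - \<tau>)) has_vector_derivative 1 *\<^sub>R f (t - \<tau>)) (at t within {\<tau>..})"
  proof (rule vector_diff_chain_within)
    show "((\<lambda>u. u - \<tau>) has_vector_derivative 1) (at t within {\<tau>..})"
      by (auto intro!: derivative_eq_intros)
    have "(\<lambda>u. u - \<tau>) ` {\<tau>..} \<subseteq> {0..}" by auto
    then show "(?I has_vector_derivative f (t - \<tau>)) (at (t - \<tau>) within (\<lambda>u. u - \<tau>) ` {\<tau>..})"
      using assms
      by (intro has_vector_derivative_within_subset[OF integral_from_0_has_vector_derivative]) auto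
  qed
  ultimately have diff: "((\<lambda>u. ?I u - ?I (u - \<tau>)) has_vector_derivative f t - f (t - \<tau>)) (at t within {\<tau>..})"
    using has_vector_derivative_diff by (fastforce simp: o_def)
  have "integral {u - \<tau>..u} f = ?I u - ?I (u - \<tau>)" if "u \<in> {\<tau>..}" for u
  proof -
    have "f integrable_on {0..u}"
      by (intro integrable_continuous_real continuous_on_subset[OF f]) auto
    from Henstock_Kurzweil_Integration.integral_combine[OF _ _ this, of "u - \<tau>"] show ?thesis
      using that \<open>0 \<le> \<tau>\<close> by (simp add: algebra_simps)
  qed
  then show ?thesis
    using \<open>\<tau> \<le> t\<close> by (intro has_vector_derivative_transform[OF _ _ diff]) auto
qed

text \<open>
  The coefficients are those of the differential operator with characteristic function
  \<open>(z - l)\<^sup>2 * (1 - kernel_transform \<alpha> \<beta> \<tau> (z - l))\<close>; the function \<open>f\<close> collects whatever is left over. The second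
  equation is only required after one delay, when \<open>\<omega> (t - \<tau>)\<close> is the derivative of \<open>\<theta>\<close> at \<open>t - \<tau>\<close>.
\<close>

locale perturbed_delayed_feedback = probability_kernel \<alpha> \<beta> \<tau> for \<alpha> \<beta> \<tau> :: real +
  fixes l :: real and \<theta> \<omega> f :: "real \<Rightarrow> real"
  assumes \<theta>_deriv: "\<And>t. 0 \<le> t \<Longrightarrow> (\<theta> has_real_derivative \<omega> t) (at t within {0..})"
    and \<omega>_deriv: "\<And>t. \<tau> \<le> t \<Longrightarrow> (\<omega> has_real_derivative
        (2 * l + \<alpha>) * \<omega> t - (\<beta> + l\<^sup>2 + \<alpha> * l) * \<theta> t
        - (\<alpha> - \<beta> * \<tau>) * exp (l * \<tau>) * \<omega> (t - \<tau>)
        + (\<beta> + l * (\<alpha> - \<beta> * \<tau>)) * exp (l * \<tau>) * \<theta> (t - \<tau>) + f t) (at t within {\<tau>..})"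
begin

definition weighted :: "real \<Rightarrow> real" where
  "weighted t = exp (- l * t) * \<theta> t"

definition weighted_deriv :: "real \<Rightarrow> real" where
  "weighted_deriv t = exp (- l * t) * (\<omega> t - l * \<theta> t)"

text \<open>
  The deviation of the weighted angle from its average under the density \<open>\<alpha> - \<beta> * r\<close>. In the time domain it
  is the counterpart of the factor \<open>1 - kernel_transform \<alpha> \<beta> \<tau>\<close>, and the equation satisfied by its second derivative is the
  counterpart of the factor \<open>(z - l)\<^sup>2\<close>, shifted to the origin by the weight.
\<close>

definition defect :: "real \<Rightarrow> real" where
  "defect t = weighted t - integral {t - \<tau>..t} (\<lambda>s. (\<alpha> - \<beta> * (t - s)) * weighted s)"

definition defect_deriv :: "real \<Rightarrow> real" where
  "defect_deriv t = weighted_deriv t - \<alpha> * weighted t + (\<alpha> - \<beta> * \<tau>) * weighted (t - \<tau>)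
     + \<beta> * integral {t - \<tau>..t} weighted"

lemma weighted_has_derivative:
  "0 \<le> t \<Longrightarrow> (weighted has_real_derivative weighted_deriv t) (at t within {0..})"
  unfolding weighted_def[abs_def] weighted_deriv_def
  by (auto intro!: derivative_eq_intros \<theta>_deriv simp: algebra_simps)

lemma weighted_cont: "S \<subseteq> {0..} \<Longrightarrow> continuous_on S weighted"
  using weighted_has_derivative
  by (intro continuous_on_subset[of "{0..}" weighted S] DERIV_continuous_on) auto

lemma weighted_shift_has_derivative:
  assumes "\<tau> \<le> t"
  shows "((\<lambda>t. weighted (t - \<tau>)) has_real_derivative weighted_deriv (t - \<tau>)) (at t within {\<tau>..})"
proof -
  have shifted: "(weighted has_real_derivative weighted_deriv (t - \<tau>)) (at (t - \<tau>) within (\<lambda>u. u - \<tau>) ` {\<tau>..})"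
    by (rule DERIV_subset[OF weighted_has_derivative]) (use assms in auto)
  have shift: "((\<lambda>u. u - \<tau>) has_real_derivative 1) (at t within {\<tau>..})"
    by (auto intro!: derivative_eq_intros)
  show ?thesis
    using DERIV_image_chain[OF shifted shift] by (simp add: o_def)
qed

text \<open>
  The kernel depends on \<open>t\<close>, but only affinely: the averaging integral is a combination of two window
  integrals whose integrands are free of \<open>t\<close>, and the fundamental theorem of calculus applies to each.
\<close>

lemma defect_has_derivative:
  assumes "\<tau> \<le> t"
  shows "(defect has_real_derivative defect_deriv t) (at t within {\<tau>..})"
proof -
  let ?J0 = "\<lambda>t. integral {t - \<tau>..t} weighted"
    and ?J1 = "\<lambda>t. integral {t - \<tau>..t} (\<lambda>s. s * weighted s)"
  have J0: "(?J0 has_real_derivative weighted t - weighted (t - \<tau>)) (at t within {\<tau>..})"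
    and J1: "(?J1 has_real_derivative t * weighted t - (t - \<tau>) * weighted (t - \<tau>)) (at t within {\<tau>..})"
    unfolding has_real_derivative_iff_has_vector_derivative using assms delay_pos
    by (intro window_integral_has_vector_derivative continuous_intros weighted_cont; simp)+
  have w: "(weighted has_real_derivative weighted_deriv t) (at t within {\<tau>..})"
    by (rule DERIV_subset[OF weighted_has_derivative]) (use assms delay_pos in auto)
  have expanded: "((\<lambda>t. weighted t - ((\<alpha> - \<beta> * t) * ?J0 t + \<beta> * ?J1 t)) has_real_derivative defect_deriv t)
      (at t within {\<tau>..})"
    by (auto intro!: derivative_eq_intros w J0 J1 simp: defect_deriv_def algebra_simps)
  have "defect u = weighted u - ((\<alpha> - \<beta> * u) * ?J0 u + \<beta> * ?J1 u)" if "u \<in> {\<tau>..}" for u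
  proof -
    have "weighted integrable_on {u - \<tau>..u}" "(\<lambda>s. s * weighted s) integrable_on {u - \<tau>..u}"
      using that by (auto intro!: integrable_continuous_real continuous_intros weighted_cont)
    then have "((\<lambda>s. (\<alpha> - \<beta> * u) * weighted s + \<beta> * (s * weighted s)) has_integral
        (\<alpha> - \<beta> * u) * ?J0 u + \<beta> * ?J1 u) {u - \<tau>..u}"
      by (intro has_integral_add has_integral_mult_right integrable_integral)
    then have "integral {u - \<tau>..u} (\<lambda>s. (\<alpha> - \<beta> * (u - s)) * weighted s)
        = (\<alpha> - \<beta> * u) * ?J0 u + \<beta> * ?J1 u"
      by (intro integral_unique) (simp add: algebra_simps)
    then show ?thesis by (simp add: defect_def)
  qed
  then show ?thesis
    using assms by (intro has_field_derivative_transform_within[OF expanded, of 1]) auto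
qed

text \<open>
  This is the factorization of the characteristic function in the time domain: all terms with delayed
  or undelayed states cancel, and only the weighted perturbation survives.
\<close>

lemma defect_deriv_has_derivative:
  assumes "\<tau> \<le> t"
  shows "(defect_deriv has_real_derivative exp (- l * t) * f t) (at t within {\<tau>..})"
proof -
  let ?J0 = "\<lambda>t. integral {t - \<tau>..t} weighted"
  have J0: "(?J0 has_real_derivative weighted t - weighted (t - \<tau>)) (at t within {\<tau>..})"
    unfolding has_real_derivative_iff_has_vector_derivative using assms delay_pos
    by (intro window_integral_has_vector_derivative continuous_intros weighted_cont; simp)
  have w: "(weighted has_real_derivative weighted_deriv t) (at t within {\<tau>..})"
    by (rule DERIV_subset[OF weighted_has_derivative]) (use assms delay_pos in auto)
  have th: "(\<theta> has_real_derivative \<omega> t) (at t within {\<tau>..})"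
    by (rule DERIV_subset[OF \<theta>_deriv]) (use assms delay_pos in auto)
  define \<omega>' where "\<omega>' = (2 * l + \<alpha>) * \<omega> t - (\<beta> + l\<^sup>2 + \<alpha> * l) * \<theta> t
        - (\<alpha> - \<beta> * \<tau>) * exp (l * \<tau>) * \<omega> (t - \<tau>)
        + (\<beta> + l * (\<alpha> - \<beta> * \<tau>)) * exp (l * \<tau>) * \<theta> (t - \<tau>) + f t"
  have w2: "(weighted_deriv has_real_derivative
      exp (- l * t) * (\<omega>' - l * \<omega> t) - l * exp (- l * t) * (\<omega> t - l * \<theta> t)) (at t within {\<tau>..})"
    unfolding weighted_deriv_def[abs_def]
    by (auto intro!: derivative_eq_intros th \<omega>_deriv[OF assms, folded \<omega>'_def] simp: algebra_simps)
  have "(defect_deriv has_real_derivative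
      (exp (- l * t) * (\<omega>' - l * \<omega> t) - l * exp (- l * t) * (\<omega> t - l * \<theta> t))
      - \<alpha> * weighted_deriv t + (\<alpha> - \<beta> * \<tau>) * weighted_deriv (t - \<tau>)
      + \<beta> * (weighted t - weighted (t - \<tau>))) (at t within {\<tau>..})"
    unfolding defect_deriv_def[abs_def]
    by (auto intro!: derivative_eq_intros w w2 J0 weighted_shift_has_derivative[OF assms])
  also have "(exp (- l * t) * (\<omega>' - l * \<omega> t) - l * exp (- l * t) * (\<omega> t - l * \<theta> t))
      - \<alpha> * weighted_deriv t + (\<alpha> - \<beta> * \<tau>) * weighted_deriv (t - \<tau>)
      + \<beta> * (weighted t - weighted (t - \<tau>)) = exp (- l * t) * f t"
  proof -
    have e: "exp (- l * (t - \<tau>)) = exp (- l * t) * exp (l * \<tau>)"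
      by (simp add: algebra_simps flip: exp_add)
    show ?thesis
      unfolding weighted_def weighted_deriv_def \<omega>'_def e by (simp add: algebra_simps power2_eq_square)
  qed
  finally show ?thesis .
qed

text \<open>
  Averaging contracts the supremum weighted by \<open>exp (- m * t)\<close> with factor \<open>kernel_transform \<alpha> \<beta> \<tau> m < 1\<close>. The
  unweighted mass is one, so there is no contraction for \<open>m = 0\<close>; a little of the decay rate has to
  be given up.
\<close>

lemma kernel_integral_le:
  fixes m :: real
  assumes t: "\<tau> \<le> t" and m: "m > 0"
    and bound: "\<And>s. s \<in> {t - \<tau>..t} \<Longrightarrow> \<bar>weighted s\<bar> \<le> M * exp (m * s)"
  shows "\<bar>integral {t - \<tau>..t} (\<lambda>s. (\<alpha> - \<beta> * (t - s)) * weighted s)\<bar>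
    \<le> kernel_transform \<alpha> \<beta> \<tau> m * M * exp (m * t)"
proof -
  have "((\<lambda>s. (\<alpha> - \<beta> * (t - s)) * exp (m * s)) has_integral
      exp (m * t) * kernel_transform \<alpha> \<beta> \<tau> m) {t - \<tau>..t}"
    using kernel_window_has_integral[of m \<tau> \<alpha> \<beta> t] kernel_transform_eq[of m \<tau> \<alpha> \<beta>] m delay_pos
    by simp
  from has_integral_mult_right[OF this, of M]
  have I: "((\<lambda>s. (\<alpha> - \<beta> * (t - s)) * (M * exp (m * s))) has_integral
      kernel_transform \<alpha> \<beta> \<tau> m * M * exp (m * t)) {t - \<tau>..t}"
    by (simp add: mult_ac)
  have "norm (integral {t - \<tau>..t} (\<lambda>s. (\<alpha> - \<beta> * (t - s)) * weighted s))
      \<le> integral {t - \<tau>..t} (\<lambda>s. (\<alpha> - \<beta> * (t - s)) * (M * exp (m * s)))"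
  proof (rule integral_norm_bound_integral)
    show "(\<lambda>s. (\<alpha> - \<beta> * (t - s)) * weighted s) integrable_on {t - \<tau>..t}"
      using t by (intro integrable_continuous_real continuous_intros weighted_cont) auto
    fix s assume s: "s \<in> {t - \<tau>..t}"
    then show "norm ((\<alpha> - \<beta> * (t - s)) * weighted s) \<le> (\<alpha> - \<beta> * (t - s)) * (M * exp (m * s))"
      using kernel_nonneg[of "t - s"] bound[OF s] by (simp add: abs_mult mult_left_mono)
  qed (use I in blast)
  then show ?thesis using I by (simp add: integral_unique)
qed

lemma window_integral_le:
  assumes t: "\<tau> \<le> t" and bound: "\<And>s. s \<in> {t - \<tau>..t} \<Longrightarrow> \<bar>weighted s\<bar> \<le> B"
  shows "\<bar>integral {t - \<tau>..t} weighted\<bar> \<le> \<tau> * B"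
  using integral_bound[of "t - \<tau>" t weighted B] weighted_cont[of "{t - \<tau>..t}"] assms delay_pos
  by (auto simp: mult.commute)

lemma defect_deriv_le:
  fixes m :: real
  assumes t: "\<tau> \<le> t" "t \<le> T" and m: "m > 0" and M: "M \<ge> 0"
    and \<theta>: "\<And>s. s \<in> {0..T} \<Longrightarrow> \<bar>weighted s\<bar> \<le> M * exp (m * s)"
    and \<gamma>: "\<gamma> \<ge> 0" and f: "\<And>s. s \<in> {\<tau>..T} \<Longrightarrow> \<bar>f s\<bar> \<le> \<gamma> * \<bar>\<theta> s\<bar>"
  shows "\<bar>defect_deriv t\<bar> \<le> (\<bar>defect_deriv \<tau>\<bar> + \<gamma> * M / m) * exp (m * t)"
proof -
  have "norm (defect_deriv t) \<le> norm (defect_deriv \<tau>) + \<gamma> * M / m * exp (m * t)"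
  proof (rule norm_le_exp[where f' = "\<lambda>t. exp (- l * t) * f t"])
    fix s assume s: "s \<in> {\<tau>..t}"
    then show "(defect_deriv has_vector_derivative exp (- l * s) * f s) (at s within {\<tau>..t})"
      unfolding has_real_derivative_iff_has_vector_derivative[symmetric]
      by (intro DERIV_subset[OF defect_deriv_has_derivative]) auto
    have "norm (exp (- l * s) * f s) \<le> exp (- l * s) * (\<gamma> * \<bar>\<theta> s\<bar>)"
      using f[of s] s t by (simp add: abs_mult)
    also have "\<dots> = \<gamma> * \<bar>weighted s\<bar>" by (simp add: weighted_def abs_mult)
    also have "\<dots> \<le> \<gamma> * (M * exp (m * s))"
      using s t delay_pos by (intro mult_left_mono \<theta> \<gamma>) auto
    finally show "norm (exp (- l * s) * f s) \<le> \<gamma> * M * exp (m * s)" by simp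
  qed (use t m M \<gamma> in auto)
  moreover have "\<bar>defect_deriv \<tau>\<bar> \<le> \<bar>defect_deriv \<tau>\<bar> * exp (m * t)"
    using m t delay_pos by (simp add: mult_le_cancel_left1)
  ultimately show ?thesis by (simp add: algebra_simps)
qed

text \<open>
  Two integrations of the second derivative of the defect produce \<open>\<gamma> / m\<^sup>2\<close>, and the average contributes the
  kernel transform. When the two add up to less than one, the estimate closes.
\<close>

lemma weighted_le:
  fixes m :: real
  assumes t: "\<tau> \<le> t" "t \<le> T" and m: "m > 0" and M: "M \<ge> 0"
    and \<theta>: "\<And>s. s \<in> {0..T} \<Longrightarrow> \<bar>weighted s\<bar> \<le> M * exp (m * s)"
    and \<gamma>: "\<gamma> \<ge> 0" and f: "\<And>s. s \<in> {\<tau>..T} \<Longrightarrow> \<bar>f s\<bar> \<le> \<gamma> * \<bar>\<theta> s\<bar>"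
  shows "\<bar>weighted t\<bar> \<le> (\<bar>defect \<tau>\<bar> + \<bar>defect_deriv \<tau>\<bar> / m
    + (\<gamma> / m\<^sup>2 + kernel_transform \<alpha> \<beta> \<tau> m) * M) * exp (m * t)"
proof -
  define C where "C = \<bar>defect_deriv \<tau>\<bar> + \<gamma> * M / m"
  have "norm (defect t) \<le> norm (defect \<tau>) + C / m * exp (m * t)"
  proof (rule norm_le_exp[where f' = defect_deriv])
    fix s assume s: "s \<in> {\<tau>..t}"
    then show "(defect has_vector_derivative defect_deriv s) (at s within {\<tau>..t})"
      unfolding has_real_derivative_iff_has_vector_derivative[symmetric]
      by (intro DERIV_subset[OF defect_has_derivative]) auto
    show "norm (defect_deriv s) \<le> C * exp (m * s)"
      using defect_deriv_le[of s T m M \<gamma>] s t m M \<theta> \<gamma> f by (simp add: C_def)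
  qed (use t m M \<gamma> in \<open>auto simp: C_def\<close>)
  moreover have "\<bar>defect \<tau>\<bar> \<le> \<bar>defect \<tau>\<bar> * exp (m * t)"
    using m t delay_pos by (simp add: mult_le_cancel_left1)
  moreover have "\<bar>weighted t\<bar> \<le> \<bar>defect t\<bar> + kernel_transform \<alpha> \<beta> \<tau> m * M * exp (m * t)"
    using kernel_integral_le[of t m M] t m \<theta> delay_pos by (simp add: defect_def)
  moreover have "C / m = \<bar>defect_deriv \<tau>\<bar> / m + \<gamma> / m\<^sup>2 * M"
    using m by (simp add: C_def field_simps power2_eq_square)
  ultimately show ?thesis by (simp add: algebra_simps)
qed

end

section \<open>Exponential decay under small perturbations\<close>

context perturbed_delayed_feedback
begin

text \<open>At time \<open>\<tau>\<close> the defect and its derivative involve the solution on \<open>[0, \<tau>]\<close> only.\<close>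

lemma initial_defect_le:
  fixes m :: real
  assumes m: "m > 0" and l: "l < 0" and P: "P \<ge> 0"
    and init: "\<And>s. s \<in> {0..\<tau>} \<Longrightarrow> \<bar>\<theta> s\<bar> \<le> P \<and> \<bar>\<omega> s\<bar> \<le> P"
  shows "\<bar>defect \<tau>\<bar> \<le> (1 + exp (m * \<tau>)) * exp (- l * \<tau>) * P"
    and "\<bar>defect_deriv \<tau>\<bar> \<le> (1 - l + 2 * \<alpha> - \<beta> * \<tau> + \<bar>\<beta>\<bar> * \<tau>) * exp (- l * \<tau>) * P"
proof -
  define E where "E = exp (- l * \<tau>)"
  have E: "E > 0" by (simp add: E_def)
  have e: "exp (- l * s) \<le> E" if "s \<in> {0..\<tau>}" for s
    using that l by (simp add: E_def mult_left_mono_neg)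
  have w: "\<bar>weighted s\<bar> \<le> E * P" if "s \<in> {0..\<tau>}" for s
    unfolding weighted_def abs_mult using that init[OF that] e[OF that] P E by (intro mult_mono) auto
  have "\<bar>weighted s\<bar> \<le> E * P * exp (m * s)" if "s \<in> {\<tau> - \<tau>..\<tau>}" for s
  proof -
    have "E * P \<le> E * P * exp (m * s)"
      using that mult_left_mono[of 1 "exp (m * s)" "E * P"] E P m by simp
    then show ?thesis using w[of s] that by simp
  qed
  from kernel_integral_le[OF order_refl m this]
  have "\<bar>defect \<tau>\<bar> \<le> E * P + kernel_transform \<alpha> \<beta> \<tau> m * (E * P) * exp (m * \<tau>)"
    using w[of \<tau>] delay_pos by (simp add: defect_def)
  also have "\<dots> \<le> E * P + 1 * (E * P) * exp (m * \<tau>)"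
    using kernel_transform_less_one[OF m] E P by (intro add_left_mono mult_right_mono) auto
  finally show "\<bar>defect \<tau>\<bar> \<le> (1 + exp (m * \<tau>)) * exp (- l * \<tau>) * P"
    by (simp add: E_def algebra_simps)
  have "\<bar>weighted_deriv \<tau>\<bar> \<le> E * ((1 - l) * P)"
  proof -
    have "\<bar>\<omega> \<tau> - l * \<theta> \<tau>\<bar> \<le> \<bar>\<omega> \<tau>\<bar> + - l * \<bar>\<theta> \<tau>\<bar>"
      using abs_triangle_ineq4[of "\<omega> \<tau>" "l * \<theta> \<tau>"] l by (simp add: abs_mult)
    also have "\<dots> \<le> P + - l * P"
      using init[of \<tau>] delay_pos l by (intro add_mono mult_left_mono) auto
    also have "\<dots> = (1 - l) * P" by (simp add: algebra_simps)
    finally show ?thesis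
      unfolding weighted_deriv_def abs_mult E_def by (intro mult_mono) auto
  qed
  moreover have "\<bar>\<alpha> * weighted \<tau>\<bar> \<le> \<alpha> * (E * P)"
    using w[of \<tau>] \<alpha>_pos delay_pos by (simp add: abs_mult)
  moreover have "\<bar>(\<alpha> - \<beta> * \<tau>) * weighted (\<tau> - \<tau>)\<bar> \<le> (\<alpha> - \<beta> * \<tau>) * (E * P)"
    unfolding abs_mult using w[of 0] end_nonneg delay_pos by (intro mult_mono) auto
  moreover have "\<bar>\<beta> * integral {\<tau> - \<tau>..\<tau>} weighted\<bar> \<le> \<bar>\<beta>\<bar> * (\<tau> * (E * P))"
    unfolding abs_mult using window_integral_le[of \<tau> "E * P"] w by (intro mult_left_mono) auto
  ultimately have "\<bar>defect_deriv \<tau>\<bar> \<le> E * ((1 - l) * P) + \<alpha> * (E * P) + (\<alpha> - \<beta> * \<tau>) * (E * P)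
      + \<bar>\<beta>\<bar> * (\<tau> * (E * P))"
    unfolding defect_deriv_def by linarith
  then show "\<bar>defect_deriv \<tau>\<bar> \<le> (1 - l + 2 * \<alpha> - \<beta> * \<tau> + \<bar>\<beta>\<bar> * \<tau>) * exp (- l * \<tau>) * P"
    by (simp add: E_def algebra_simps)
qed

text \<open>The derivative of the defect contains \<open>\<omega>\<close>, and all its other terms are controlled by \<open>\<theta>\<close>.\<close>

lemma velocity_le:
  fixes m :: real
  assumes m: "m > 0" and l: "l < 0" and t: "\<tau> \<le> t" and M: "M \<ge> 0"
    and \<theta>: "\<And>s. s \<in> {0..t} \<Longrightarrow> \<bar>weighted s\<bar> \<le> M * exp (m * s)"
    and D: "\<bar>defect_deriv t\<bar> \<le> D * exp (m * t)"
  shows "exp (- l * t) * \<bar>\<omega> t\<bar> \<le> (D + (2 * \<alpha> - \<beta> * \<tau> + \<bar>\<beta>\<bar> * \<tau> - l) * M) * exp (m * t)"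
proof -
  define B where "B = M * exp (m * t)"
  have w: "\<bar>weighted s\<bar> \<le> B" if "s \<in> {0..t}" for s
  proof -
    have "M * exp (m * s) \<le> B" unfolding B_def using that m M by (intro mult_left_mono) auto
    then show ?thesis using \<theta>[OF that] by simp
  qed
  have "exp (- l * t) * \<omega> t = defect_deriv t + \<alpha> * weighted t - (\<alpha> - \<beta> * \<tau>) * weighted (t - \<tau>)
     - \<beta> * integral {t - \<tau>..t} weighted + l * weighted t"
    by (simp add: defect_deriv_def weighted_deriv_def weighted_def algebra_simps)
  moreover have "\<bar>\<alpha> * weighted t\<bar> \<le> \<alpha> * B"
    unfolding abs_mult using w[of t] \<alpha>_pos t delay_pos by (intro mult_mono) auto
  moreover have "\<bar>(\<alpha> - \<beta> * \<tau>) * weighted (t - \<tau>)\<bar> \<le> (\<alpha> - \<beta> * \<tau>) * B"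
    unfolding abs_mult using w[of "t - \<tau>"] end_nonneg t delay_pos by (intro mult_mono) auto
  moreover have "\<bar>\<beta> * integral {t - \<tau>..t} weighted\<bar> \<le> \<bar>\<beta>\<bar> * (\<tau> * B)"
    unfolding abs_mult using window_integral_le[OF t, of B] w t by (intro mult_left_mono) auto
  moreover have "\<bar>l * weighted t\<bar> \<le> - l * B"
    unfolding abs_mult using w[of t] l t delay_pos by (intro mult_mono) auto
  ultimately have "\<bar>exp (- l * t) * \<omega> t\<bar>
      \<le> \<bar>defect_deriv t\<bar> + \<alpha> * B + (\<alpha> - \<beta> * \<tau>) * B + \<bar>\<beta>\<bar> * (\<tau> * B) + - l * B"
    by linarith
  also have "\<dots> \<le> D * exp (m * t) + \<alpha> * B + (\<alpha> - \<beta> * \<tau>) * B + \<bar>\<beta>\<bar> * (\<tau> * B) + - l * B"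
    using D by simp
  finally show ?thesis by (simp add: abs_mult B_def algebra_simps)
qed

end

text \<open>
  The weighted maximum \<open>M\<close> of \<open>\<theta>\<close> over \<open>[0, T]\<close> either is attained before \<open>\<tau>\<close>, where the initial bound \<open>P\<close>
  controls it, or satisfies \<open>M \<le> c * P + (1 + q) / 2 * M\<close> with \<open>q < 1\<close>. The constants do not
  depend on the solution or on \<open>T\<close>, which is what the nonlinear argument requires: there the bound on \<open>f\<close> is known
  only as long as the solution is small.
\<close>

lemma (in probability_kernel) perturbed_feedback_decays:
  assumes l: "l < 0" and \<nu>: "0 < \<nu>" "\<nu> < - l"
  shows "\<exists>\<gamma>>0. \<exists>C\<ge>1. \<forall>\<theta> \<omega> f P T.
    perturbed_delayed_feedback \<alpha> \<beta> \<tau> l \<theta> \<omega> f \<longrightarrow>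
    (\<forall>s\<in>{0..\<tau>}. \<bar>\<theta> s\<bar> \<le> P \<and> \<bar>\<omega> s\<bar> \<le> P) \<longrightarrow>
    (\<forall>s\<in>{\<tau>..T}. \<bar>f s\<bar> \<le> \<gamma> * \<bar>\<theta> s\<bar>) \<longrightarrow>
    (\<forall>t\<in>{0..T}. \<bar>\<theta> t\<bar> \<le> C * P * exp (- \<nu> * t) \<and> \<bar>\<omega> t\<bar> \<le> C * P * exp (- \<nu> * t))"
proof -
  define m where "m = - l - \<nu>"
  have m: "m > 0" using \<nu> by (simp add: m_def)
  define q where "q = kernel_transform \<alpha> \<beta> \<tau> m"
  have q: "q < 1" unfolding q_def using m by (rule kernel_transform_less_one)
  \<comment> \<open>With this choice \<open>\<gamma> / m\<^sup>2 + q\<close> lies halfway between \<open>q\<close> and one.\<close>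
  define \<gamma> where "\<gamma> = m\<^sup>2 * (1 - q) / 2"
  have \<gamma>: "\<gamma> > 0" using m q by (simp add: \<gamma>_def)
  define A1 where "A1 = (1 + exp (m * \<tau>)) * exp (- l * \<tau>)"
  define A2 where "A2 = (1 - l + 2 * \<alpha> - \<beta> * \<tau> + \<bar>\<beta>\<bar> * \<tau>) * exp (- l * \<tau>)"
  have A1: "A1 \<ge> 0" by (simp add: A1_def)
  have A2: "A2 \<ge> 0"
    unfolding A2_def using l \<alpha>_pos end_nonneg delay_pos
    by (intro mult_nonneg_nonneg add_nonneg_nonneg) auto
  define A3 where "A3 = exp (\<nu> * \<tau>) + 2 * (A1 + A2 / m) / (1 - q)"
  have frac: "2 * (A1 + A2 / m) / (1 - q) \<ge> 0"
    using A1 A2 m q by simp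
  have "exp (\<nu> * \<tau>) \<ge> 1" using \<nu> delay_pos by simp
  with frac have A3: "A3 \<ge> 1" unfolding A3_def by linarith
  define A4 where "A4 = A2 + \<gamma> * A3 / m + (2 * \<alpha> - \<beta> * \<tau> + \<bar>\<beta>\<bar> * \<tau> - l) * A3"
  define C where "C = A3 + \<bar>A4\<bar>"
  have C: "C \<ge> 1" "A3 \<le> C" "A4 \<le> C" using A3 by (auto simp: C_def)
  have "\<bar>\<theta> t\<bar> \<le> C * P * exp (- \<nu> * t) \<and> \<bar>\<omega> t\<bar> \<le> C * P * exp (- \<nu> * t)"
    if sys: "perturbed_delayed_feedback \<alpha> \<beta> \<tau> l \<theta> \<omega> f"
      and init: "\<And>s. s \<in> {0..\<tau>} \<Longrightarrow> \<bar>\<theta> s\<bar> \<le> P \<and> \<bar>\<omega> s\<bar> \<le> P"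
      and f: "\<And>s. s \<in> {\<tau>..T} \<Longrightarrow> \<bar>f s\<bar> \<le> \<gamma> * \<bar>\<theta> s\<bar>" and t: "t \<in> {0..T}"
    for \<theta> \<omega> f P T t
  proof -
    interpret perturbed_delayed_feedback \<alpha> \<beta> \<tau> l \<theta> \<omega> f by (rule sys)
    have P: "P \<ge> 0" using init[of 0] delay_pos by auto
    have w_eq: "exp (- m * s) * \<bar>weighted s\<bar> = exp (\<nu> * s) * \<bar>\<theta> s\<bar>" for s
      by (simp add: weighted_def m_def abs_mult algebra_simps flip: mult.assoc exp_add)
    have "continuous_on {0..T} (\<lambda>s. exp (- m * s) * \<bar>weighted s\<bar>)"
      by (intro continuous_intros weighted_cont) auto
    then obtain c where c: "c \<in> {0..T}"
      and c_max: "\<And>s. s \<in> {0..T} \<Longrightarrow> exp (- m * s) * \<bar>weighted s\<bar> \<le> exp (- m * c) * \<bar>weighted c\<bar>"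
      using continuous_attains_sup[of "{0..T}" "\<lambda>s. exp (- m * s) * \<bar>weighted s\<bar>"] t by auto
    define M where "M = exp (- m * c) * \<bar>weighted c\<bar>"
    have M: "M \<ge> 0" by (simp add: M_def)
    have w: "\<bar>weighted s\<bar> \<le> M * exp (m * s)" if "s \<in> {0..T}" for s
      using c_max[OF that] by (simp add: M_def exp_minus field_simps)
    have early: "exp (\<nu> * s) * x \<le> exp (\<nu> * \<tau>) * P" if "s \<in> {0..\<tau>}" "0 \<le> x" "x \<le> P" for s x
      using that \<nu> by (intro mult_mono) auto
    have M_le: "M \<le> A3 * P"
    proof (cases "c \<le> \<tau>")
      case True
      then have "M \<le> exp (\<nu> * \<tau>) * P"
        using c init unfolding M_def w_eq by (intro early) auto
      also have "\<dots> \<le> A3 * P" using frac P by (intro mult_right_mono) (auto simp: A3_def)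
      finally show ?thesis .
    next
      case False
      have "\<bar>weighted c\<bar> \<le> (\<bar>defect \<tau>\<bar> + \<bar>defect_deriv \<tau>\<bar> / m + (\<gamma> / m\<^sup>2 + q) * M) * exp (m * c)"
        unfolding q_def using False c m M w \<gamma> f by (intro weighted_le[of c T]) auto
      from mult_left_mono[OF this, of "exp (- m * c)"]
      have "M \<le> \<bar>defect \<tau>\<bar> + \<bar>defect_deriv \<tau>\<bar> / m + (\<gamma> / m\<^sup>2 + q) * M"
        by (simp add: M_def mult.left_commute[of "exp (- (m * c))"] flip: exp_add)
      also have "\<gamma> / m\<^sup>2 + q = (1 + q) / 2"
        using m by (simp add: \<gamma>_def field_simps)
      also have "\<bar>defect \<tau>\<bar> + \<bar>defect_deriv \<tau>\<bar> / m \<le> A1 * P + A2 * P / m"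
        using initial_defect_le[OF m l P init] m unfolding A1_def A2_def
        by (intro add_mono divide_right_mono) auto
      finally have "(1 - q) / 2 * M \<le> (A1 + A2 / m) * P" by (simp add: field_simps)
      then have "M \<le> 2 * (A1 + A2 / m) / (1 - q) * P" using q by (simp add: field_simps)
      also have "\<dots> \<le> A3 * P" using P by (intro mult_right_mono) (auto simp: A3_def)
      finally show ?thesis .
    qed
    have "exp (\<nu> * t) * \<bar>\<theta> t\<bar> \<le> A3 * P"
      using c_max[OF t] M_le unfolding w_eq M_def by linarith
    also have "\<dots> \<le> C * P" using C P by (intro mult_right_mono)
    finally have 1: "exp (\<nu> * t) * \<bar>\<theta> t\<bar> \<le> C * P" .
    have 2: "exp (\<nu> * t) * \<bar>\<omega> t\<bar> \<le> C * P"
    proof (cases "t \<le> \<tau>")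
      case True
      then have "exp (\<nu> * t) * \<bar>\<omega> t\<bar> \<le> exp (\<nu> * \<tau>) * P"
        using t init by (intro early) auto
      also have "\<dots> \<le> A3 * P" using frac P by (intro mult_right_mono) (auto simp: A3_def)
      also have "\<dots> \<le> C * P" using C P by (intro mult_right_mono)
      finally show ?thesis .
    next
      case False
      define D where "D = \<bar>defect_deriv \<tau>\<bar> + \<gamma> * M / m"
      have "\<bar>defect_deriv t\<bar> \<le> D * exp (m * t)"
        unfolding D_def using False t m M w \<gamma> f by (intro defect_deriv_le[of t T]) auto
      then have "exp (- l * t) * \<bar>\<omega> t\<bar> \<le> (D + (2 * \<alpha> - \<beta> * \<tau> + \<bar>\<beta>\<bar> * \<tau> - l) * M) * exp (m * t)"
        using False t m l M w by (intro velocity_le) auto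
      moreover have "exp (- l * t) = exp (\<nu> * t) * exp (m * t)"
        by (simp add: m_def algebra_simps flip: exp_add)
      ultimately have "exp (\<nu> * t) * \<bar>\<omega> t\<bar> \<le> D + (2 * \<alpha> - \<beta> * \<tau> + \<bar>\<beta>\<bar> * \<tau> - l) * M"
        by (simp add: mult_ac)
      also have "\<dots> \<le> (A2 * P + \<gamma> * (A3 * P) / m) + (2 * \<alpha> - \<beta> * \<tau> + \<bar>\<beta>\<bar> * \<tau> - l) * (A3 * P)"
      proof (intro add_mono mult_left_mono M_le)
        show "D \<le> A2 * P + \<gamma> * (A3 * P) / m"
          unfolding D_def using initial_defect_le(2)[OF m l P init] M_le m \<gamma> unfolding A2_def
          by (intro add_mono divide_right_mono mult_left_mono) auto
        have "\<alpha> + (\<alpha> - \<beta> * \<tau>) + \<bar>\<beta>\<bar> * \<tau> + - l \<ge> 0"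
          using \<alpha>_pos end_nonneg delay_pos l by (intro add_nonneg_nonneg) auto
        then show "0 \<le> 2 * \<alpha> - \<beta> * \<tau> + \<bar>\<beta>\<bar> * \<tau> - l" by simp
      qed
      also have "\<dots> = A4 * P" by (simp add: A4_def algebra_simps)
      also have "\<dots> \<le> C * P" using C P by (intro mult_right_mono)
      finally show ?thesis .
    qed
    have unweight: "x \<le> C * P * exp (- \<nu> * t)" if "exp (\<nu> * t) * x \<le> C * P" for x
      using that by (simp add: exp_minus field_simps)
    show ?thesis using 1 2 unweight by blast
  qed
  with \<gamma> C(1) show ?thesis by blast
qed

section \<open>The controlled pendulum\<close>

text \<open>
  A continuity argument. At the first time at which \<open>h\<close> reaches \<open>\<rho>\<close> the hypothesis of \<open>improve\<close> holds, and its
  conclusion is contradicted.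
\<close>

lemma stays_below_threshold:
  fixes h :: "real \<Rightarrow> real"
  assumes cont: "continuous_on {0..} h" and h0: "h 0 \<le> \<rho>"
    and improve: "\<And>T. 0 \<le> T \<Longrightarrow> (\<And>s. s \<in> {0..T} \<Longrightarrow> h s \<le> \<rho>) \<Longrightarrow> h T < \<rho>"
    and t: "0 \<le> t"
  shows "h t < \<rho>"
proof (rule ccontr)
  assume "\<not> h t < \<rho>"
  have cont': "continuous_on {0..s} h" for s
    using cont by (rule continuous_on_subset) auto
  define S where "S = {s \<in> {0..t}. h s = \<rho>}"
  have "closed S"
    unfolding S_def by (intro continuous_closed_preimage_constant cont') auto
  moreover have "bounded S"
    by (rule bounded_subset[of "{0..t}"]) (auto simp: S_def)
  ultimately have "compact S" by (simp add: compact_eq_bounded_closed)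
  moreover have "S \<noteq> {}"
    using IVT'[OF h0 _ t cont'] \<open>\<not> h t < \<rho>\<close> by (auto simp: S_def)
  ultimately obtain T where T: "T \<in> S" and least: "\<And>s. s \<in> S \<Longrightarrow> T \<le> s"
    using compact_attains_inf[of S] by auto
  have "h s \<le> \<rho>" if s: "s \<in> {0..T}" for s
  proof (rule ccontr)
    assume "\<not> h s \<le> \<rho>"
    then obtain s' where "0 \<le> s'" "s' \<le> s" "h s' = \<rho>"
      using IVT'[OF h0 _ _ cont'[of s]] s by auto
    then have "s' \<in> S" using s T by (auto simp: S_def)
    from least[OF this] have "s = s'" using s \<open>s' \<le> s\<close> by auto
    then show False using \<open>h s' = \<rho>\<close> \<open>\<not> h s \<le> \<rho>\<close> by simp
  qed
  then have "h T < \<rho>" using T by (intro improve) (auto simp: S_def)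
  then show False using T by (simp add: S_def)
qed

lemma pendulum_lipschitz:
  assumes "g > 0" "L > 0"
  shows "lipschitz_field (1 + g / L + \<bar>kp\<bar> + \<bar>kd\<bar>) (pendulum_closed_loop g L kp kd)"
  unfolding lipschitz_field_def
proof (intro conjI allI)
  show "0 < 1 + g / L + \<bar>kp\<bar> + \<bar>kd\<bar>"
    using assms by (simp add: add_pos_pos add_pos_nonneg)
  fix x y x' y' :: "real \<times> real"
  let ?a = "norm (x - x')" and ?b = "norm (y - y')"
  have comp: "\<bar>fst x - fst x'\<bar> \<le> ?a" "\<bar>snd x - snd x'\<bar> \<le> ?a" "\<bar>fst y - fst y'\<bar> \<le> ?b" "\<bar>snd y - snd y'\<bar> \<le> ?b"
    using dist_fst_le[of x x'] dist_snd_le[of x x'] dist_fst_le[of y y'] dist_snd_le[of y y']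
    by (simp_all add: dist_norm)
  have "\<bar>sin (fst x) - sin (fst x')\<bar> \<le> \<bar>fst x - fst x'\<bar>"
  proof -
    have "\<bar>sin (fst x) - sin (fst x')\<bar> = 2 * \<bar>sin ((fst x - fst x') / 2)\<bar> * \<bar>cos ((fst x + fst x') / 2)\<bar>"
      by (simp add: sin_diff_sin abs_mult)
    also have "\<dots> \<le> 2 * \<bar>(fst x - fst x') / 2\<bar> * 1"
      by (intro mult_mono mult_left_mono abs_sin_x_le_abs_x) auto
    finally show ?thesis by simp
  qed
  then have "\<bar>g / L * (sin (fst x) - sin (fst x'))\<bar> \<le> g / L * ?a"
    unfolding abs_mult using assms comp(1) by (intro mult_mono) auto
  moreover have "\<bar>kp * (fst y - fst y')\<bar> \<le> \<bar>kp\<bar> * ?b" "\<bar>kd * (snd y - snd y')\<bar> \<le> \<bar>kd\<bar> * ?b"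
    unfolding abs_mult using comp by (intro mult_left_mono; simp)+
  moreover have "pendulum_closed_loop g L kp kd x y - pendulum_closed_loop g L kp kd x' y'
      = (snd x - snd x', - (g / L * (sin (fst x) - sin (fst x'))) - kp * (fst y - fst y') - kd * (snd y - snd y'))"
    by (simp add: pendulum_closed_loop_def pendulum_field_def pd_control_def algebra_simps)
  moreover have "norm (snd x - snd x', - (g / L * (sin (fst x) - sin (fst x'))) - kp * (fst y - fst y') - kd * (snd y - snd y'))
     \<le> \<bar>snd x - snd x'\<bar> + \<bar>- (g / L * (sin (fst x) - sin (fst x'))) - kp * (fst y - fst y') - kd * (snd y - snd y')\<bar>"
    by (rule order_trans[OF norm_Pair_le]) simp
  ultimately have "norm (pendulum_closed_loop g L kp kd x y - pendulum_closed_loop g L kp kd x' y')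
      \<le> ?a + g / L * ?a + \<bar>kp\<bar> * ?b + \<bar>kd\<bar> * ?b"
    using comp(2) by (simp only:) linarith
  also have "\<dots> \<le> (1 + g / L + \<bar>kp\<bar> + \<bar>kd\<bar>) * (?a + ?b)"
  proof -
    have "0 \<le> (\<bar>kp\<bar> + \<bar>kd\<bar>) * ?a + (1 + g / L) * ?b" using assms by simp
    then show ?thesis by (simp add: distrib_left distrib_right)
  qed
  finally show "norm (pendulum_closed_loop g L kp kd x y - pendulum_closed_loop g L kp kd x' y')
      \<le> (1 + g / L + \<bar>kp\<bar> + \<bar>kd\<bar>) * (?a + ?b)" .
qed

context probability_kernel
begin

text \<open>
  Since \<open>\<bar>\<theta> - sin \<theta>\<bar> \<le> \<theta>\<^sup>2 / 2\<close>, the deviation from the linearization is dominated by \<open>\<gamma> * \<bar>\<theta>\<bar>\<close> while \<open>\<bar>\<theta>\<bar> \<le> \<rho>\<close>. The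
  linear estimate then gives \<open>\<bar>\<theta>\<bar> \<le> \<rho> / 2\<close> for initial functions of size at most \<open>\<delta>\<close>, so that the threshold \<open>\<rho>\<close> is
  never reached and the estimate is valid for all time.
\<close>

lemma pendulum_locally_exponentially_stable:
  assumes g: "g > 0" "L > 0" and l: "l < 0"
    and \<alpha>: "\<alpha> = - 2 * l" and \<beta>: "\<beta> = g / L + l\<^sup>2"
    and kd: "kd = (\<alpha> - \<beta> * \<tau>) * exp (l * \<tau>)"
    and kp: "kp = - (\<beta> + l * (\<alpha> - \<beta> * \<tau>)) * exp (l * \<tau>)"
  shows "locally_exponentially_stable \<tau> (pendulum_closed_loop g L kp kd)"
proof -
  let ?F = "pendulum_closed_loop g L kp kd"
  \<comment> \<open>Any rate strictly between \<open>0\<close> and \<open>- l\<close> would do.\<close>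
  define \<nu> where "\<nu> = - l / 2"
  have \<nu>: "0 < \<nu>" "\<nu> < - l" using l by (auto simp: \<nu>_def)
  from perturbed_feedback_decays[OF l \<nu>] obtain \<gamma> C where \<gamma>: "\<gamma> > 0" and C: "C \<ge> 1"
    and decay: "\<And>\<theta> \<omega> f P T t. perturbed_delayed_feedback \<alpha> \<beta> \<tau> l \<theta> \<omega> f \<Longrightarrow>
      (\<forall>s\<in>{0..\<tau>}. \<bar>\<theta> s\<bar> \<le> P \<and> \<bar>\<omega> s\<bar> \<le> P) \<Longrightarrow>
      (\<forall>s\<in>{\<tau>..T}. \<bar>f s\<bar> \<le> \<gamma> * \<bar>\<theta> s\<bar>) \<Longrightarrow> t \<in> {0..T} \<Longrightarrow>
      \<bar>\<theta> t\<bar> \<le> C * P * exp (- \<nu> * t) \<and> \<bar>\<omega> t\<bar> \<le> C * P * exp (- \<nu> * t)"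
    by metis
  define Lip where "Lip = 1 + g / L + \<bar>kp\<bar> + \<bar>kd\<bar>"
  have F: "lipschitz_field Lip ?F" "?F 0 0 = 0"
    unfolding Lip_def using g
    by (auto intro!: pendulum_lipschitz simp: pendulum_closed_loop_def pendulum_field_def pd_control_def zero_prod_def)
  define C0 where "C0 = 4 * exp (4 * Lip * \<tau>)"
  have C0: "C0 > 0" by (simp add: C0_def)
  define \<rho> where "\<rho> = 2 * \<gamma> * L / g"
  have \<rho>: "\<rho> > 0" using \<gamma> g by (simp add: \<rho>_def)
  define \<delta> where "\<delta> = \<rho> / (2 * (C * C0))"
  have CC0: "C * C0 > 0" using C C0 by simp
  then have \<delta>: "\<delta> > 0" using \<rho> by (simp add: \<delta>_def)
  have bound: "norm (x t) \<le> 2 * (C * C0) * exp (- \<nu> * t) * N"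
    if phi: "\<And>s. s \<in> {-\<tau>..0} \<Longrightarrow> norm (\<phi> s) \<le> N" and N: "N \<le> \<delta>"
      and sol: "dde_solution \<tau> ?F \<phi> x" and t: "t \<ge> 0" for \<phi> x N t
  proof -
    define \<theta> \<omega> where "\<theta> t = fst (x t)" and "\<omega> t = snd (x t)" for t
    define f where "f t = g / L * (\<theta> t - sin (\<theta> t))" for t
    have x_deriv: "(x has_vector_derivative ?F (x t) (x (t - \<tau>))) (at t within {0..})" if "t \<ge> 0" for t
      using sol that by (simp add: dde_solution_def)
    have \<theta>_deriv: "(\<theta> has_real_derivative \<omega> t) (at t within {0..})" if "t \<ge> 0" for t
      using bounded_linear.has_vector_derivative[OF bounded_linear_fst x_deriv[OF that]]
      by (simp add: \<theta>_def[abs_def] \<omega>_def pendulum_closed_loop_def pendulum_field_def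
          has_real_derivative_iff_has_vector_derivative)
    have \<omega>_deriv: "(\<omega> has_real_derivative - (g / L) * sin (\<theta> t) + (- kp * \<theta> (t - \<tau>) - kd * \<omega> (t - \<tau>)))
        (at t within {0..})" if "t \<ge> 0" for t
      using bounded_linear.has_vector_derivative[OF bounded_linear_snd x_deriv[OF that]]
      by (simp add: \<theta>_def \<omega>_def[abs_def] pendulum_closed_loop_def pendulum_field_def pd_control_def
          has_real_derivative_iff_has_vector_derivative)
    have sys: "perturbed_delayed_feedback \<alpha> \<beta> \<tau> l \<theta> \<omega> f"
    proof unfold_locales
      fix t assume "\<tau> \<le> t"
      then have "(\<omega> has_real_derivative - (g / L) * sin (\<theta> t) + (- kp * \<theta> (t - \<tau>) - kd * \<omega> (t - \<tau>)))
          (at t within {\<tau>..})"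
        using delay_pos by (intro DERIV_subset[OF \<omega>_deriv]) auto
      also have "- (g / L) * sin (\<theta> t) + (- kp * \<theta> (t - \<tau>) - kd * \<omega> (t - \<tau>)) =
          (2 * l + \<alpha>) * \<omega> t - (\<beta> + l\<^sup>2 + \<alpha> * l) * \<theta> t
          - (\<alpha> - \<beta> * \<tau>) * exp (l * \<tau>) * \<omega> (t - \<tau>)
          + (\<beta> + l * (\<alpha> - \<beta> * \<tau>)) * exp (l * \<tau>) * \<theta> (t - \<tau>) + f t"
      proof -
        have "2 * l + \<alpha> = 0" "\<beta> + l\<^sup>2 + \<alpha> * l = g / L"
          by (simp_all add: \<alpha> \<beta> power2_eq_square)
        moreover have "(\<beta> + l * (\<alpha> - \<beta> * \<tau>)) * exp (l * \<tau>) = - kp"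
          unfolding kp by (simp only: mult_minus_left minus_minus)
        ultimately show ?thesis
          unfolding f_def kd[symmetric] by (simp add: right_diff_distrib)
      qed
      finally show "(\<omega> has_real_derivative \<dots>) (at t within {\<tau>..})" .
    qed (rule \<theta>_deriv)
    define P where "P = C0 * N"
    have init: "\<bar>\<theta> s\<bar> \<le> P \<and> \<bar>\<omega> s\<bar> \<le> P" if "s \<in> {0..\<tau>}" for s
      using dde_solution_first_interval_bound[OF sol delay_pos F phi that]
        dist_fst_le[of "x s" 0] dist_snd_le[of "x s" 0]
      by (auto simp: P_def C0_def \<theta>_def \<omega>_def)
    have P: "P \<ge> 0" using init[of 0] delay_pos by auto
    have CP: "C * P \<le> \<rho> / 2"
    proof -
      have "C * P \<le> C * C0 * \<delta>"
        using mult_left_mono[OF N, of "C * C0"] CC0 by (simp add: P_def mult.assoc)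
      then show ?thesis using CC0 C C0 by (simp add: \<delta>_def)
    qed
    have small: "\<bar>f s\<bar> \<le> \<gamma> * \<bar>\<theta> s\<bar>" if "\<bar>\<theta> s\<bar> \<le> \<rho>" for s
    proof -
      have "\<bar>\<theta> s - sin (\<theta> s)\<bar> \<le> \<bar>\<theta> s\<bar> / 2 * \<bar>\<theta> s\<bar>"
        using Maclaurin_sin_bound[of "\<theta> s" 2] abs_minus_commute[of "\<theta> s" "sin (\<theta> s)"]
        by (simp add: sin_coeff_def numeral_2_eq_2 lessThan_Suc)
      also have "\<dots> \<le> \<rho> / 2 * \<bar>\<theta> s\<bar>"
        using that by (intro mult_right_mono) auto
      finally have "g / L * \<bar>\<theta> s - sin (\<theta> s)\<bar> \<le> g / L * (\<rho> / 2 * \<bar>\<theta> s\<bar>)"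
        using g by (intro mult_left_mono) auto
      also have "g / L * (\<rho> / 2 * \<bar>\<theta> s\<bar>) = \<gamma> * \<bar>\<theta> s\<bar>"
        using g by (simp add: \<rho>_def)
      finally show ?thesis using g by (simp add: f_def abs_mult)
    qed
    have below: "\<bar>\<theta> t\<bar> < \<rho>" if "t \<ge> 0" for t
    proof (rule stays_below_threshold[where h = "\<lambda>t. \<bar>\<theta> t\<bar>"])
      show "continuous_on {0..} (\<lambda>t. \<bar>\<theta> t\<bar>)"
        using \<theta>_deriv by (intro continuous_on_rabs DERIV_continuous_on) auto
      have "P \<le> C * P" using C P by (simp add: mult_le_cancel_right1)
      then show "\<bar>\<theta> 0\<bar> \<le> \<rho>" using init[of 0] delay_pos CP \<rho> by auto
      fix T :: real assume T: "0 \<le> T" "\<And>s. s \<in> {0..T} \<Longrightarrow> \<bar>\<theta> s\<bar> \<le> \<rho>"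
      have "\<forall>s\<in>{\<tau>..T}. \<bar>f s\<bar> \<le> \<gamma> * \<bar>\<theta> s\<bar>"
        using delay_pos by (intro ballI small T(2)) auto
      from decay[OF sys _ this, of P T] have "\<bar>\<theta> T\<bar> \<le> C * P * exp (- \<nu> * T)"
        using init T(1) by simp
      also have "\<dots> \<le> C * P * 1"
        using C P \<nu> T by (intro mult_left_mono) auto
      finally show "\<bar>\<theta> T\<bar> < \<rho>" using CP \<rho> by simp
    qed (use that in auto)
    have "\<bar>\<theta> t\<bar> \<le> C * P * exp (- \<nu> * t) \<and> \<bar>\<omega> t\<bar> \<le> C * P * exp (- \<nu> * t)"
    proof (rule decay[OF sys, of P t t])
      show "\<forall>s\<in>{\<tau>..t}. \<bar>f s\<bar> \<le> \<gamma> * \<bar>\<theta> s\<bar>"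
        using delay_pos by (intro ballI small less_imp_le below) auto
    qed (use t init in auto)
    moreover have "norm (x t) \<le> \<bar>\<theta> t\<bar> + \<bar>\<omega> t\<bar>"
      using norm_Pair_le[of "fst (x t)" "snd (x t)"] by (simp add: \<theta>_def \<omega>_def)
    ultimately show ?thesis by (simp add: P_def mult_ac)
  qed
  have K: "2 * (C * C0) > 0" using CC0 by simp
  show ?thesis
    unfolding locally_exponentially_stable_def
  proof (rule exI[of _ \<delta>], rule conjI[OF \<delta>], rule exI[of _ "2 * (C * C0)"], rule conjI[OF K],
      rule exI[of _ \<nu>], rule conjI[OF \<nu>(1)], intro conjI allI impI)
    fix \<phi> :: "real \<Rightarrow> real \<times> real"
    assume phi: "continuous_on {-\<tau>..0} \<phi>" and N: "(SUP s\<in>{-\<tau>..0}. norm (\<phi> s)) \<le> \<delta>"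
    show "\<exists>x. dde_solution \<tau> ?F \<phi> x"
      by (rule lipschitz_dde_solution_exists[OF delay_pos F(1) phi])
    have "compact ((\<lambda>s. norm (\<phi> s)) ` {-\<tau>..0})"
      by (intro compact_continuous_image continuous_intros phi) simp
    then have "bdd_above ((\<lambda>s. norm (\<phi> s)) ` {-\<tau>..0})"
      by (intro bounded_imp_bdd_above compact_imp_bounded)
    then have "norm (\<phi> s) \<le> (SUP s\<in>{-\<tau>..0}. norm (\<phi> s))" if "s \<in> {-\<tau>..0}" for s
      using that by (intro cSUP_upper)
    then show "norm (x t) \<le> 2 * (C * C0) * exp (- \<nu> * t) * (SUP s\<in>{-\<tau>..0}. norm (\<phi> s))"
      if "dde_solution \<tau> ?F \<phi> x" "t \<ge> 0" for x t
      using that by (intro bound[OF _ N])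
  qed
qed

lemma closed_loop_roots:
  fixes z :: complex
  assumes \<alpha>: "\<alpha> = - 2 * l"
    and kd: "kd = (\<alpha> - \<beta> * \<tau>) * exp (l * \<tau>)"
    and kp: "kp = - (\<beta> + l * (\<alpha> - \<beta> * \<tau>)) * exp (l * \<tau>)"
    and root: "z\<^sup>2 + of_real (\<beta> - l\<^sup>2) + (of_real kd * z + of_real kp) * exp (- z * of_real \<tau>) = 0"
  shows "Re z \<le> l"
proof (rule ccontr)
  assume "\<not> Re z \<le> l"
  define w where "w = z - of_real l"
  have w: "Re w > 0" "w \<noteq> 0" using \<open>\<not> Re z \<le> l\<close> by (auto simp: w_def)
  have e: "exp (- w * of_real \<tau>) = exp (- z * of_real \<tau>) * of_real (exp (l * \<tau>))"
    by (simp add: w_def algebra_simps flip: exp_add exp_of_real)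
  have "w\<^sup>2 * (1 - kernel_transform \<alpha> \<beta> \<tau> w) = 0"
  proof -
    have "w\<^sup>2 * (1 - kernel_transform \<alpha> \<beta> \<tau> w) = w\<^sup>2 - of_real \<alpha> * w + of_real \<beta>
      + (of_real (\<alpha> - \<beta> * \<tau>) * w - of_real \<beta>) * exp (- w * of_real \<tau>)"
      using w delay_pos by (intro quasipolynomial_factorization) auto
    also have "w\<^sup>2 - of_real \<alpha> * w + of_real \<beta> = z\<^sup>2 + of_real (\<beta> - l\<^sup>2)"
      by (simp add: w_def \<alpha> power2_eq_square algebra_simps)
    also have "(of_real (\<alpha> - \<beta> * \<tau>) * w - of_real \<beta>) * exp (- w * of_real \<tau>)
        = (of_real kd * z + of_real kp) * exp (- z * of_real \<tau>)"
      unfolding e kd kp by (simp add: w_def algebra_simps)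
    finally show ?thesis using root by simp
  qed
  then have "kernel_transform \<alpha> \<beta> \<tau> w = 1" using w by simp
  then show False using norm_kernel_transform_less_one[OF w(1)] by simp
qed

text \<open>
  In terms of the factorization, two of the three orders come from \<open>(z - l)\<^sup>2\<close> and the third from
  the mass being one. The Taylor coefficients of \<open>\<Delta>\<close> at \<open>l\<close> show this directly: the second one is a multiple of
  \<open>1 - (\<alpha> * \<tau> - \<beta> * \<tau>\<^sup>2 / 2)\<close>, and the third is a positive multiple of \<open>2 * (\<alpha> - \<beta> * \<tau>) + \<alpha>\<close>.
\<close>

lemma closed_loop_zorder:
  assumes \<alpha>: "\<alpha> = - 2 * l"
    and kd: "kd = (\<alpha> - \<beta> * \<tau>) * exp (l * \<tau>)"
    and kp: "kp = - (\<beta> + l * (\<alpha> - \<beta> * \<tau>)) * exp (l * \<tau>)"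
  defines "\<Delta> \<equiv> \<lambda>z::complex. z\<^sup>2 + of_real (\<beta> - l\<^sup>2) + (of_real kd * z + of_real kp) * exp (- z * of_real \<tau>)"
  shows "\<Delta> (of_real l) = 0" and "zorder \<Delta> (of_real l) = 3"
proof -
  define E where "E z = exp (- z * of_real \<tau>)" for z :: complex
  define Q where "Q z = of_real kd * z + of_real kp" for z :: complex
  define \<Delta>1 where "\<Delta>1 z = 2 * z + (of_real kd - of_real \<tau> * Q z) * E z" for z
  define \<Delta>2 where "\<Delta>2 z = 2 + ((of_real \<tau>)\<^sup>2 * Q z - 2 * of_real \<tau> * of_real kd) * E z" for z
  define \<Delta>3 where "\<Delta>3 z = (3 * (of_real \<tau>)\<^sup>2 * of_real kd - (of_real \<tau>) ^ 3 * Q z) * E z" for z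
  have E: "(E has_field_derivative - of_real \<tau> * E z) (at z)" for z
    unfolding E_def[abs_def] by (auto intro!: derivative_eq_intros)
  have Q: "(Q has_field_derivative of_real kd) (at z)" for z
    unfolding Q_def[abs_def] by (auto intro!: derivative_eq_intros)
  have \<Delta>_eq: "\<Delta> = (\<lambda>z. z\<^sup>2 + of_real (\<beta> - l\<^sup>2) + Q z * E z)"
    by (simp add: \<Delta>_def Q_def E_def)
  have d0: "(\<Delta> has_field_derivative \<Delta>1 z) (at z)" for z
    unfolding \<Delta>_eq \<Delta>1_def by (auto intro!: derivative_eq_intros E Q simp: algebra_simps)
  have d1: "(\<Delta>1 has_field_derivative \<Delta>2 z) (at z)" for z
    unfolding \<Delta>1_def[abs_def] \<Delta>2_def
    by (auto intro!: derivative_eq_intros E Q simp: algebra_simps power2_eq_square)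
  have d2: "(\<Delta>2 has_field_derivative \<Delta>3 z) (at z)" for z
    unfolding \<Delta>2_def[abs_def] \<Delta>3_def
    by (auto intro!: derivative_eq_intros E Q simp: algebra_simps power2_eq_square power3_eq_cube)
  have derivs: "deriv \<Delta> = \<Delta>1" "deriv \<Delta>1 = \<Delta>2" "deriv \<Delta>2 = \<Delta>3"
    using d0 d1 d2 DERIV_imp_deriv by blast+
  define e where "e = exp (l * \<tau>)"
  have "e \<noteq> 0" by (simp add: e_def)
  have E_l: "E (of_real l) = of_real (inverse e)"
    by (simp add: E_def e_def exp_minus flip: exp_of_real)
  have Q_l: "Q (of_real l) = of_real (- \<beta> * e)"
    by (simp add: Q_def kd kp e_def algebra_simps)
  have kd_e: "kd * inverse e = \<alpha> - \<beta> * \<tau>" using \<open>e \<noteq> 0\<close> by (simp add: kd flip: e_def)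
  have v0: "\<Delta> (of_real l) = of_real (l\<^sup>2 + (\<beta> - l\<^sup>2) - \<beta>)"
    unfolding \<Delta>_eq Q_l E_l using \<open>e \<noteq> 0\<close> by simp
  then show root: "\<Delta> (of_real l) = 0" by simp
  have "\<Delta>1 (of_real l) = of_real (2 * l + (kd * inverse e + \<tau> * \<beta>))"
    unfolding \<Delta>1_def Q_l E_l using \<open>e \<noteq> 0\<close> by (simp add: algebra_simps)
  then have v1: "\<Delta>1 (of_real l) = 0" unfolding kd_e using \<alpha> by (simp add: algebra_simps)
  have "\<Delta>2 (of_real l) = of_real (2 - 2 * \<tau> * (kd * inverse e) - \<tau>\<^sup>2 * \<beta>)"
    unfolding \<Delta>2_def Q_l E_l using \<open>e \<noteq> 0\<close> by (simp add: algebra_simps)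
  also have "2 - 2 * \<tau> * (kd * inverse e) - \<tau>\<^sup>2 * \<beta> = 2 - 2 * (\<alpha> * \<tau> - \<beta> * \<tau>\<^sup>2 / 2)"
    unfolding kd_e by (simp add: algebra_simps power2_eq_square)
  finally have v2: "\<Delta>2 (of_real l) = 0" unfolding mass by simp
  have "\<Delta>3 (of_real l) = of_real (\<tau>\<^sup>2 * (3 * (kd * inverse e) + \<tau> * \<beta>))"
    unfolding \<Delta>3_def Q_l E_l using \<open>e \<noteq> 0\<close> by (simp add: algebra_simps power2_eq_square power3_eq_cube)
  also have "\<tau>\<^sup>2 * (3 * (kd * inverse e) + \<tau> * \<beta>) = \<tau>\<^sup>2 * (2 * (\<alpha> - \<beta> * \<tau>) + \<alpha>)"
    unfolding kd_e by (simp add: algebra_simps)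
  finally have v3: "\<Delta>3 (of_real l) \<noteq> 0"
    using delay_pos end_nonneg \<alpha>_pos by (simp del: of_real_mult of_real_add of_real_power)
  show "zorder \<Delta> (of_real l) = 3"
  proof (rule zorder_zero_eqI[where S = UNIV])
    show "\<Delta> holomorphic_on UNIV"
      using d0 by (auto simp: holomorphic_on_open)
    show "(deriv ^^ i) \<Delta> (of_real l) = 0" if "i < nat 3" for i
    proof -
      from that consider "i = 0" | "i = 1" | "i = 2" by linarith
      then show ?thesis by cases (auto simp: derivs root v1 v2 numeral_2_eq_2)
    qed
    show "(deriv ^^ nat 3) \<Delta> (of_real l) \<noteq> 0"
      using v3 by (simp add: derivs numeral_3_eq_3)
  qed auto
qed

end

theorem proposition11:
  fixes g L \<tau> lam0 kd kp :: real and \<Delta> :: "complex \<Rightarrow> complex"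
  assumes "g > 0" and "L > 0"
    and "0 < \<tau>" and "\<tau> < sqrt (2 * L / g)"
    and "lam0 = (- 2 + sqrt (- (g * \<tau>\<^sup>2 / L) + 2)) / \<tau>"
    and "lam0 * \<tau> \<ge> - 1"
    and "kd = 2 * (\<tau> * lam0 + 1) * exp (\<tau> * lam0) / \<tau>"
    and "kp = 2 * (5 * L * \<tau> * lam0 + g * \<tau>\<^sup>2 + 3 * L) * exp (\<tau> * lam0) / (\<tau>\<^sup>2 * L)"
    and "\<Delta> = (\<lambda>z. z\<^sup>2 + of_real (g / L) + (of_real kd * z + of_real kp) * exp (- z * of_real \<tau>))"
  shows "locally_exponentially_stable \<tau> (pendulum_closed_loop g L kp kd)
    \<and> intermediate_MID_property \<tau> 2 1 \<Delta> (of_real lam0)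
    \<and> \<Delta> (of_real lam0) = 0
    \<and> zorder \<Delta> (of_real lam0) = 3
    \<and> (\<forall>z. \<Delta> z = 0 \<longrightarrow> Re z \<le> lam0)
    \<and> spectral_abscissa \<Delta> = lam0"
proof -
  \<comment> \<open>After rescaling time by \<open>\<tau>\<close> only two dimensionless parameters remain, and the definition of
     \<open>lam0\<close> ties them together by the quadratic equation \<open>w\<^sup>2 + 4 * w + 2 + a = 0\<close>.\<close>
  define a w where "a = g * \<tau>\<^sup>2 / L" and "w = \<tau> * lam0"
  define \<alpha> \<beta> where "\<alpha> = - 2 * lam0" and "\<beta> = g / L + lam0\<^sup>2"
  have "a > 0" using assms(1-3) by (simp add: a_def)
  have "\<tau>\<^sup>2 < 2 * L / g"
    using assms(1-4) real_sqrt_less_iff[of "\<tau>\<^sup>2" "2 * L / g"] by simp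
  then have "a < 2" using assms(1,2) by (simp add: a_def field_simps)
  have w_eq: "w = - 2 + sqrt (2 - a)"
    using assms(3,5) by (simp add: w_def a_def)
  have "(w + 2)\<^sup>2 = 2 - a" using \<open>a < 2\<close> by (simp add: w_eq)
  then have quadratic: "a = - (w\<^sup>2 + 4 * w + 2)" by (simp add: power2_eq_square algebra_simps)
  have "sqrt (2 - a) < 2" using \<open>a > 0\<close> by (intro real_less_lsqrt) (use \<open>a < 2\<close> in auto)
  then have "w < 0" by (simp add: w_eq)
  then have l: "lam0 < 0" using assms(3) by (simp add: w_def mult_less_0_iff)
  have w1: "w \<ge> - 1" using assms(6) by (simp add: w_def mult.commute)
  have \<beta>_scaled: "\<beta> * \<tau>\<^sup>2 = - (4 * w + 2)"
  proof -
    have "\<beta> * \<tau>\<^sup>2 = a + w\<^sup>2" by (simp add: \<beta>_def a_def w_def power2_eq_square algebra_simps)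
    then show ?thesis using quadratic by simp
  qed
  have end_eq: "\<alpha> - \<beta> * \<tau> = 2 * (w + 1) / \<tau>"
  proof -
    have "(\<alpha> - \<beta> * \<tau>) * \<tau> = - 2 * w - \<beta> * \<tau>\<^sup>2"
      by (simp add: \<alpha>_def w_def power2_eq_square algebra_simps)
    then show ?thesis using assms(3) by (simp add: \<beta>_scaled field_simps)
  qed
  interpret probability_kernel \<alpha> \<beta> \<tau>
  proof
    show "0 \<le> \<alpha> - \<beta> * \<tau>" unfolding end_eq using w1 assms(3) by simp
    have "\<alpha> * \<tau> = - 2 * w" by (simp add: \<alpha>_def w_def)
    then show "\<alpha> * \<tau> - \<beta> * \<tau>\<^sup>2 / 2 = 1" by (simp add: \<beta>_scaled diff_divide_distrib)
  qed (use assms(3) l in \<open>auto simp: \<alpha>_def\<close>)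
  have kd: "kd = (\<alpha> - \<beta> * \<tau>) * exp (lam0 * \<tau>)"
    unfolding end_eq assms(7) by (simp add: w_def mult.commute)
  have kp: "kp = - (\<beta> + lam0 * (\<alpha> - \<beta> * \<tau>)) * exp (lam0 * \<tau>)"
  proof -
    have "2 * (5 * L * \<tau> * lam0 + g * \<tau>\<^sup>2 + 3 * L) / (\<tau>\<^sup>2 * L) = 2 * (5 * w + a + 3) / \<tau>\<^sup>2"
      using assms(2,3) by (simp add: a_def w_def field_simps)
    also have "\<dots> = - (\<beta> * \<tau>\<^sup>2 + w * (2 * (w + 1))) / \<tau>\<^sup>2"
      unfolding \<beta>_scaled quadratic by (simp add: algebra_simps power2_eq_square)
    also have "\<dots> = - (\<beta> + lam0 * (\<alpha> - \<beta> * \<tau>))"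
      unfolding end_eq using assms(3) by (simp add: w_def field_simps power2_eq_square)
    finally have "2 * (5 * L * \<tau> * lam0 + g * \<tau>\<^sup>2 + 3 * L) / (\<tau>\<^sup>2 * L) = - (\<beta> + lam0 * (\<alpha> - \<beta> * \<tau>))" .
    then show ?thesis unfolding assms(8) by (simp only: mult.commute[of lam0] flip: times_divide_eq_left)
  qed
  have \<Delta>: "\<Delta> = (\<lambda>z. z\<^sup>2 + of_real (\<beta> - lam0\<^sup>2) + (of_real kd * z + of_real kp) * exp (- z * of_real \<tau>))"
    using assms(9) by (simp add: \<beta>_def)
  have root: "\<Delta> (of_real lam0) = 0" and order: "zorder \<Delta> (of_real lam0) = 3"
    unfolding \<Delta> by (rule closed_loop_zorder[OF \<alpha>_def kd kp])+
  have dominant: "Re z \<le> lam0" if "\<Delta> z = 0" for z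
    using that unfolding \<Delta> by (rule closed_loop_roots[OF \<alpha>_def kd kp])
  have "spectral_abscissa \<Delta> = lam0"
    unfolding spectral_abscissa_def
    by (rule cSup_eq_maximum) (use root dominant in \<open>force+\<close>)
  moreover have "intermediate_MID_property \<tau> 2 1 \<Delta> (of_real lam0)"
    unfolding intermediate_MID_property_def
  proof (intro conjI exI)
    show "degree [:of_real (g / L), 0, 1 :: complex:] = 2" by simp
    show "degree [:of_real kp, of_real kd :: complex:] \<le> 1" by simp
    show "\<Delta> = quasipolynomial \<tau> [:of_real (g / L), 0, 1:] [:of_real kp, of_real kd:]"
      by (simp add: assms(9) quasipolynomial_def fun_eq_iff power2_eq_square algebra_simps)
    show "MID_property \<Delta> (of_real lam0)"
      using root order dominant by (auto simp: MID_property_def dominant_root_def)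
  qed (use order in auto)
  moreover have "locally_exponentially_stable \<tau> (pendulum_closed_loop g L kp kd)"
    by (rule pendulum_locally_exponentially_stable[OF assms(1,2) l \<alpha>_def \<beta>_def kd kp])
  ultimately show ?thesis using root order dominant by blast
qed

end
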